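(* Assume that $v \in L^{\infty}(\mathbb{R})$ is non-negative and not the zero potential. Assume in addition that, for some constants $C>0$ and $\alpha>2$, $$|v(x)| \leq \frac{C}{|x|^{\alpha}} \quad \text{for a.e. } x \in \mathbb{R}.$$ Then $$\lim_{L\to\infty} L^2\,\Gamma_v(L) = 0.$$
   Context: For a bounded non-negative potential $v:\mathbb{R}\to\mathbb{R}_{\geq 0}$ and $L>0$, let $h^D_L = -\frac{\mathrm{d}^2}{\mathrm{d}x^2}+v(x)$ be the self-adjoint Schrödinger operator on $L^2((-L/2,+L/2))$ with Dirichlet boundary conditions at $x=\pm L/2$. It has purely discrete spectrum; its eigenvalues, counted with multiplicity, are $\varepsilon_0(L) < \varepsilon_1(L) \leq \dots$. The spectral gap is $\Gamma_v(L) := \varepsilon_1(L)-\varepsilon_0(L)$. "Not the zero potential" means that $v$ is not zero as an element of $L^\infty(\mathbb{R})$, i.e. not almost everywhere zero. *)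

theory Defs
  imports "HOL-Analysis.Analysis" "HOL-Library.Function_Algebras"
begin

text \<open>
  Elements of \<open>L\<^sup>2((-L/2, L/2))\<close> that lie in the operator domain are represented by complex-valued
  functions on the real line: the unique representative that is continuous on \<open>[-L/2, L/2]\<close>,
  extended by \<open>0\<close>. With this normalisation the dimension of a space of such functions is the
  dimension of the corresponding subspace of \<open>L\<^sup>2((-L/2, L/2))\<close>.
\<close>

definition L2_on :: "real set \<Rightarrow> (real \<Rightarrow> complex) \<Rightarrow> bool" where
  "L2_on S f \<longleftrightarrow> f \<in> borel_measurable (lebesgue_on S) \<and>
     integrable (lebesgue_on S) (\<lambda>x. (cmod (f x))\<^sup>2)"

text \<open>\<open>f\<close> is absolutely continuous on \<open>[a, b]\<close> with a.e.\ (equivalently, weak) derivative \<open>f'\<close>.\<close>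

definition abs_cont_deriv :: "real \<Rightarrow> real \<Rightarrow> (real \<Rightarrow> complex) \<Rightarrow> (real \<Rightarrow> complex) \<Rightarrow> bool" where
  "abs_cont_deriv a b f f' \<longleftrightarrow> integrable (lebesgue_on {a..b}) f' \<and>
     (\<forall>x\<in>{a..b}. f x = f a + (LINT t|lebesgue_on {a..x}. f' t))"

text \<open>
  The graph of \<open>h\<^sup>D\<^sub>L = -d\<^sup>2/dx\<^sup>2 + v\<close> with domain \<open>H\<^sup>2((-L/2, L/2)) \<inter> H\<^sup>1\<^sub>0((-L/2, L/2))\<close>, using that
  in one dimension \<open>H\<^sup>2\<close> consists of the \<open>C\<^sup>1\<close> functions \<open>f\<close> on the closed interval whose derivative
  \<open>f'\<close> is absolutely continuous with \<open>f'' \<in> L\<^sup>2\<close>.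
\<close>

definition dirichlet_schroedinger ::
    "(real \<Rightarrow> real) \<Rightarrow> real \<Rightarrow> ((real \<Rightarrow> complex) \<times> (real \<Rightarrow> complex)) set" where
  "dirichlet_schroedinger v L = {(f, g).
     (\<forall>x. x \<notin> {-L/2..L/2} \<longrightarrow> f x = 0) \<and> f (-L/2) = 0 \<and> f (L/2) = 0 \<and>
     (\<exists>f' f''. abs_cont_deriv (-L/2) (L/2) f f' \<and> abs_cont_deriv (-L/2) (L/2) f' f'' \<and>
        L2_on {-L/2<..<L/2} f'' \<and>
        (AE x in lebesgue_on {-L/2<..<L/2}. g x = - f'' x + complex_of_real (v x) * f x))}"

definition eigenspace :: "(real \<Rightarrow> real) \<Rightarrow> real \<Rightarrow> real \<Rightarrow> (real \<Rightarrow> complex) set" where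
  "eigenspace v L \<mu> = {f. (f, \<lambda>x. complex_of_real \<mu> * f x) \<in> dirichlet_schroedinger v L}"

global_interpretation cfun: vector_space "\<lambda>(c::complex) (f::real \<Rightarrow> complex) x. c * f x"
  by standard (auto simp: fun_eq_iff algebra_simps)

text \<open>The dimension is \<open>0\<close> when \<open>\<mu>\<close> is not an eigenvalue.\<close>

definition multiplicity_ev :: "(real \<Rightarrow> real) \<Rightarrow> real \<Rightarrow> real \<Rightarrow> nat" where
  "multiplicity_ev v L \<mu> = cfun.dim (eigenspace v L \<mu>)"

text \<open>
  \<open>\<epsilon>\<^sub>n(L)\<close>, counted from \<open>n = 0\<close> with multiplicity: the least \<open>E\<close> such that the eigenvalues
  \<open>\<mu> \<le> E\<close> have total multiplicity at least \<open>n + 1\<close>. The total is taken over finite sets \<open>M\<close> since a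
  sum over an infinite set would be \<open>0\<close> by convention. As the spectrum is discrete and bounded below,
  the infimum is attained.
\<close>

definition eigenvalue :: "(real \<Rightarrow> real) \<Rightarrow> real \<Rightarrow> nat \<Rightarrow> real" where
  "eigenvalue v L n =
     Inf {E. \<exists>M. finite M \<and> M \<subseteq> {..E} \<and> n + 1 \<le> (\<Sum>\<mu>\<in>M. multiplicity_ev v L \<mu>)}"

definition spectral_gap :: "(real \<Rightarrow> real) \<Rightarrow> real \<Rightarrow> real" where
  "spectral_gap v L = eigenvalue v L 1 - eigenvalue v L 0"

end

theory Submission
  imports Defs
begin

text \<open>
  At scale \<open>L\<close> a non-zero, non-negative, fast decaying potential acts like an additional Dirichlet
  condition at the origin, so that both \<open>L\<^sup>2 \<epsilon>\<^sub>0(L)\<close> and \<open>L\<^sup>2 \<epsilon>\<^sub>1(L)\<close> tend to \<open>4 \<pi>\<^sup>2\<close>.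

  Lower bound for \<open>\<epsilon>\<^sub>0\<close>: suppose \<open>u\<close> is an eigenfunction with eigenvalue below \<open>k\<^sup>2\<close>, where
  \<open>k = (2 \<pi> - \<delta>) / L\<close>. Comparing \<open>u\<close> with \<open>sin (k (L/2 + x))\<close> and \<open>sin (k (L/2 - x))\<close> shows that a
  nodal interval of \<open>u\<close> contains any fixed \<open>[-R, R]\<close> and that \<open>\<rho> = u' / u\<close> is \<open>O(1/L)\<close> there. Since
  \<open>\<rho>' = v - \<mu> - \<rho>\<^sup>2\<close>, the integral of \<open>v\<close> over \<open>[-R, R]\<close> would be \<open>O(1/L)\<close>.

  Upper bound for \<open>\<epsilon>\<^sub>1\<close>: as \<open>\<alpha> > 2\<close>, the potential is \<open>o(1/L\<^sup>2)\<close> on \<open>\<eta> L \<le> \<bar>x\<bar>\<close>, so by Sturm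
  comparison every solution at energy \<open>((2 \<pi> + \<delta>) / L)\<^sup>2\<close> has a zero in each half of the interval.
  Hence the Pruefer angle at the right end point exceeds \<open>2 \<pi>\<close> at this energy, whereas it is below
  \<open>\<pi>\<close> at energy \<open>0\<close>; it passes through \<open>\<pi>\<close> and \<open>2 \<pi>\<close> in between, which gives two eigenvalues.
\<close>

section \<open>Solutions with bounded measurable coefficients\<close>

text \<open>The bound holds everywhere, not just almost everywhere. The potential is first replaced
  by such a representative, so that pointwise estimates carry no exceptional null sets.\<close>

definition bdd_meas :: "(real \<Rightarrow> real) \<Rightarrow> bool" where
  "bdd_meas q \<longleftrightarrow> q \<in> borel_measurable lebesgue \<and> bounded (range q)"

text \<open>
  \<open>u'' = q u\<close> with \<open>u' = w\<close>, in integrated form because \<open>q\<close> is merely measurable. The integrals are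
  Henstock--Kurzweil integrals.
\<close>

definition solves ::
    "(real \<Rightarrow> real) \<Rightarrow> real \<Rightarrow> real \<Rightarrow> (real \<Rightarrow> real) \<Rightarrow> (real \<Rightarrow> real) \<Rightarrow> bool" where
  "solves q a b u w \<longleftrightarrow> continuous_on {a..b} u \<and> continuous_on {a..b} w \<and>
     (\<forall>x\<in>{a..b}. u x = u a + integral {a..x} w) \<and>
     (\<forall>x\<in>{a..b}. w x = w a + integral {a..x} (\<lambda>t. q t * u t))"

lemma bdd_meas_const [simp]: "bdd_meas (\<lambda>_. c)"
  by (auto simp: bdd_meas_def)

lemma bdd_meas_diff: "bdd_meas p \<Longrightarrow> bdd_meas q \<Longrightarrow> bdd_meas (\<lambda>x. p x - q x)"
  by (auto simp: bdd_meas_def intro!: bounded_minus_comp)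

lemma bdd_meas_bound:
  assumes "bdd_meas q"
  obtains Q where "Q > 0" "\<And>x. \<bar>q x\<bar> \<le> Q"
  using assms unfolding bdd_meas_def bounded_pos by auto

lemma abs_integrable_bdd_meas_mult_left:
  assumes "bdd_meas q" "h absolutely_integrable_on S" "S \<in> sets lebesgue"
  shows "(\<lambda>t. q t * h t) absolutely_integrable_on S"
proof (rule absolutely_integrable_bounded_measurable_product_real[OF _ assms(3) _ assms(2)])
  show "q \<in> borel_measurable (lebesgue_on S)"
    using assms(1) by (auto simp: bdd_meas_def intro: measurable_restrict_space1)
  show "bounded (q ` S)"
    using assms(1) by (auto simp: bdd_meas_def intro: bounded_subset)
qed

lemma abs_integrable_bdd_meas_mult:
  assumes "bdd_meas q" "continuous_on {a..b} h"
  shows "(\<lambda>t. q t * h t) absolutely_integrable_on {a..b}"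
  using assms absolutely_integrable_continuous_real by (intro abs_integrable_bdd_meas_mult_left) auto

lemma integrable_bdd_meas_mult:
  assumes "bdd_meas q" "continuous_on {a..b} h"
  shows "(\<lambda>t. q t * h t) integrable_on {a..b}"
  using abs_integrable_bdd_meas_mult[OF assms] set_lebesgue_integral_eq_integral(1) by blast

lemma abs_integral_le:
  fixes f :: "real \<Rightarrow> real"
  assumes "f integrable_on {a..b}" "a \<le> b" "\<And>x. x \<in> {a..b} \<Longrightarrow> \<bar>f x\<bar> \<le> B"
  shows "\<bar>integral {a..b} f\<bar> \<le> B * (b - a)"
proof -
  have "0 \<le> B" using assms(2) assms(3)[of a] by auto
  then show ?thesis
    using has_integral_bound_real[of B "{}" f "integral {a..b} f" a b] assms by (auto simp: has_integral_iff)
qed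

text \<open>The difference quotients are \<open>O(\<bar>y - x\<bar>)\<close>, so the derivative
  vanishes on the whole interval.\<close>

lemma const_if_quadratic_increments:
  fixes f :: "real \<Rightarrow> real"
  assumes "a \<le> b" and K: "\<And>x y. a \<le> x \<Longrightarrow> x \<le> y \<Longrightarrow> y \<le> b \<Longrightarrow> \<bar>f y - f x\<bar> \<le> K * (y - x)\<^sup>2"
  shows "f b = f a"
proof -
  have K': "\<bar>f y - f x\<bar> \<le> K * (y - x)\<^sup>2" if "x \<in> {a..b}" "y \<in> {a..b}" for x y
    using K[of x y] K[of y x] that by (cases "x \<le> y") (auto simp: power2_commute abs_minus_commute)
  have "(f has_field_derivative 0) (at x within {a..b})" if x: "x \<in> {a..b}" for x
    unfolding has_field_derivative_iff
  proof (rule Lim_null_comparison)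
    show "\<forall>\<^sub>F y in at x within {a..b}. norm ((f y - f x) / (y - x)) \<le> K * \<bar>y - x\<bar>"
      unfolding eventually_at_filter
    proof (rule always_eventually, intro allI impI)
      fix y assume "y \<noteq> x" "y \<in> {a..b}"
      with K'[OF x this(2)] show "norm ((f y - f x) / (y - x)) \<le> K * \<bar>y - x\<bar>"
        by (auto simp: divide_simps power2_eq_square abs_mult mult.assoc)
    qed
    show "((\<lambda>y. K * \<bar>y - x\<bar>) \<longlongrightarrow> 0) (at x within {a..b})"
      by (auto intro!: tendsto_eq_intros)
  qed
  then obtain c where "\<forall>x\<in>{a..b}. f x = c"
    using has_field_derivative_zero_constant[of "{a..b}" f] by auto
  then show ?thesis using assms(1) by auto
qed

text \<open>
  Avoids differentiating \<open>w\<close> almost everywhere: \<open>w \<phi>\<close> minus the claimed primitive has increments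
  \<open>O((y - x)\<^sup>2)\<close>, hence is constant.
\<close>

lemma product_rule:
  fixes \<phi> w h q :: "real \<Rightarrow> real"
  assumes q: "bdd_meas q" and h: "continuous_on {a..b} h" and ab: "a \<le> b"
    and w: "\<And>x. x \<in> {a..b} \<Longrightarrow> w x = w a + integral {a..x} (\<lambda>t. q t * h t)"
    and d: "\<And>x. x \<in> {a..b} \<Longrightarrow> (\<phi> has_real_derivative \<phi>' x) (at x within {a..b})"
    and \<phi>': "continuous_on {a..b} \<phi>'"
  shows "((\<lambda>x. q x * h x * \<phi> x + w x * \<phi>' x) has_integral (w b * \<phi> b - w a * \<phi> a)) {a..b}"
proof -
  define g where "g = (\<lambda>t. q t * h t)"
  define f where "f = (\<lambda>x. g x * \<phi> x + w x * \<phi>' x)"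
  have \<phi>: "continuous_on {a..b} \<phi>"
    using d by (meson DERIV_continuous continuous_on_eq_continuous_within)
  have gi: "g integrable_on {a..b}"
    unfolding g_def by (rule integrable_bdd_meas_mult[OF q h])
  have wc: "continuous_on {a..b} w"
  proof (rule continuous_on_eq)
    show "continuous_on {a..b} (\<lambda>x. w a + integral {a..x} g)"
      by (intro continuous_intros indefinite_integral_continuous_1 gi)
  qed (simp add: w[symmetric] g_def)
  have gmult: "(\<lambda>x. g x * k x) integrable_on {a..b}" if "continuous_on {a..b} k" for k
    using integrable_bdd_meas_mult[OF q continuous_on_mult[OF h that]]
    unfolding g_def by (simp add: mult.assoc)
  have fi: "f integrable_on {a..b}"
    unfolding f_def
    by (intro integrable_add gmult \<phi> integrable_continuous_real continuous_on_mult wc \<phi>')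
  have "bounded ((\<lambda>x. h x) ` {a..b})" "bounded ((\<lambda>x. \<phi>' x) ` {a..b})"
    using h \<phi>' by (auto intro: compact_imp_bounded compact_continuous_image)
  then obtain H N where H: "H > 0" "\<And>x. x \<in> {a..b} \<Longrightarrow> \<bar>h x\<bar> \<le> H"
    and N: "N > 0" "\<And>x. x \<in> {a..b} \<Longrightarrow> \<bar>\<phi>' x\<bar> \<le> N"
    unfolding bounded_pos by (metis imageI real_norm_def)
  obtain Q where Q: "Q > 0" "\<And>x. \<bar>q x\<bar> \<le> Q" using bdd_meas_bound[OF q] by blast
  define G where "G = Q * H"
  have G: "G > 0" "\<And>x. x \<in> {a..b} \<Longrightarrow> \<bar>g x\<bar> \<le> G"
    using H Q unfolding G_def g_def by (auto simp: abs_mult intro!: mult_mono)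
  have wdiff: "w y - w x = integral {x..y} g" if "a \<le> x" "x \<le> y" "y \<le> b" for x y
  proof -
    have "integral {a..x} g + integral {x..y} g = integral {a..y} g"
      using that gi by (intro Henstock_Kurzweil_Integration.integral_combine) (auto intro: integrable_on_subinterval)
    moreover have "w x = w a + integral {a..x} g" "w y = w a + integral {a..y} g"
      unfolding g_def using w[of x] w[of y] that by auto
    ultimately show ?thesis by linarith
  qed
  have sub: "k integrable_on {x..y}" if "k integrable_on {a..b}" "a \<le> x" "y \<le> b" for k :: "real \<Rightarrow> real" and x y
    using that by (auto intro: integrable_on_subinterval)
  have \<phi>diff: "(\<phi>' has_integral (\<phi> y - \<phi> x)) {x..y}" if "a \<le> x" "x \<le> y" "y \<le> b" for x y
    using that by (intro fundamental_theorem_of_calculus)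
      (auto simp: has_real_derivative_iff_has_vector_derivative[symmetric] intro!: DERIV_subset[OF d])
  have wl: "\<bar>w y - w x\<bar> \<le> G * (y - x)" if "a \<le> x" "x \<le> y" "y \<le> b" for x y
    using wdiff[OF that] abs_integral_le[of g x y G] sub[OF gi] G that by auto
  have \<phi>l: "\<bar>\<phi> y - \<phi> x\<bar> \<le> N * (y - x)" if "a \<le> x" "x \<le> y" "y \<le> b" for x y
    using \<phi>diff[OF that] abs_integral_le[of \<phi>' x y N] N that
    by (auto simp: has_integral_iff)
  define F where "F = (\<lambda>x. w x * \<phi> x - integral {a..x} f)"
  have "F b = F a"
  proof (rule const_if_quadratic_increments[OF ab])
    fix x y assume xy: "a \<le> x" "x \<le> y" "y \<le> b"
    have fi': "integral {a..x} f + integral {x..y} f = integral {a..y} f"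
      using xy fi by (intro Henstock_Kurzweil_Integration.integral_combine) (auto intro: integrable_on_subinterval)
    \<comment> \<open>\<open>e\<close> is the integrand of \<open>F y - F x\<close> once
      \<open>\<phi>\<close> is compared with its value at \<open>y\<close> and \<open>w\<close> with
      its value at \<open>x\<close>. Both differences are \<open>O(y - x)\<close>, hence so is
      \<open>e\<close>, and integrating it gives the square.\<close>
    define e where "e = (\<lambda>s. g s * (\<phi> y - \<phi> s) - (w s - w x) * \<phi>' s)"
    have 1: "(g has_integral (w y - w x)) {x..y}"
      using wdiff[OF xy] sub[OF gi] xy by (auto simp: has_integral_iff)
    have "((\<lambda>s. g s * \<phi> y + w x * \<phi>' s - f s) has_integral
        ((w y - w x) * \<phi> y + w x * (\<phi> y - \<phi> x) - integral {x..y} f)) {x..y}"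
      using sub[OF fi, of x y] xy
      by (intro has_integral_diff has_integral_add has_integral_mult_left has_integral_mult_right 1 \<phi>diff)
         (auto simp: has_integral_iff)
    also have "(\<lambda>s. g s * \<phi> y + w x * \<phi>' s - f s) = e"
      by (auto simp: e_def f_def algebra_simps)
    also have "(w y - w x) * \<phi> y + w x * (\<phi> y - \<phi> x) - integral {x..y} f = F y - F x"
      using fi' by (simp add: F_def algebra_simps)
    finally have e: "(e has_integral (F y - F x)) {x..y}" .
    have "\<bar>e s\<bar> \<le> 2 * (G * N) * (y - x)" if s: "s \<in> {x..y}" for s
    proof -
      have "\<bar>g s * (\<phi> y - \<phi> s)\<bar> \<le> G * (N * (y - x))"
        unfolding abs_mult using G(2)[of s] \<phi>l[of s y] s xy N(1) G(1)
        by (intro mult_mono) (auto intro: order_trans[OF _ mult_left_mono])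
      moreover have "\<bar>(w s - w x) * \<phi>' s\<bar> \<le> (G * (y - x)) * N"
        unfolding abs_mult using N(2)[of s] wl[of x s] s xy N(1) G(1)
        by (intro mult_mono) (auto intro: order_trans[OF _ mult_left_mono])
      ultimately show ?thesis unfolding e_def by (auto simp: algebra_simps)
    qed
    then have "\<bar>integral {x..y} e\<bar> \<le> 2 * (G * N) * (y - x) * (y - x)"
      using e xy by (intro abs_integral_le) auto
    then show "\<bar>F y - F x\<bar> \<le> 2 * (G * N) * (y - x)\<^sup>2"
      using e by (simp add: integral_unique power2_eq_square mult.assoc)
  qed
  then have "integral {a..b} f = w b * \<phi> b - w a * \<phi> a" by (simp add: F_def)
  with fi show ?thesis unfolding f_def g_def by (simp add: has_integral_iff)
qed

section \<open>Calculus of solutions and Wronskians\<close>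

lemma solvesD:
  assumes "solves q a b u w"
  shows "continuous_on {a..b} u" "continuous_on {a..b} w"
    and "x \<in> {a..b} \<Longrightarrow> u x = u a + integral {a..x} w"
    and "x \<in> {a..b} \<Longrightarrow> w x = w a + integral {a..x} (\<lambda>t. q t * u t)"
  using assms unfolding solves_def by blast+

text \<open>Since \<open>w\<close> is continuous, the fundamental theorem of calculus gives
  \<open>u\<close> a classical derivative, one-sided at the end points. This lets solutions serve as
  test functions in \<open>product_rule\<close>.\<close>

lemma solves_deriv:
  assumes "solves q a b u w" "x \<in> {a..b}"
  shows "(u has_real_derivative w x) (at x within {a..b})"
proof -
  have "((\<lambda>x. u a + integral {a..x} w) has_real_derivative 0 + w x) (at x within {a..b})"
    using assms by (intro DERIV_add DERIV_const integral_has_real_derivative solvesD(2)[OF assms(1)])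
  then have "((\<lambda>x. u a + integral {a..x} w) has_real_derivative w x) (at x within {a..b})" by simp
  then show ?thesis
  proof (rule has_field_derivative_transform_within[where d = 1])
    fix y assume "y \<in> {a..b}"
    then show "u a + integral {a..y} w = u y"
      using assms(1) unfolding solves_def by metis
  qed (use assms in auto)
qed

lemma solves_subinterval:
  assumes "solves q a b u w" "bdd_meas q" "a \<le> c" "c \<le> d" "d \<le> b"
  shows "solves q c d u w"
proof -
  note s = solvesD(1,2)[OF assms(1)] and u = solvesD(3)[OF assms(1)] and w = solvesD(4)[OF assms(1)]
  have i: "w integrable_on {a..b}" "(\<lambda>t. q t * u t) integrable_on {a..b}"
    using s assms(2) integrable_continuous_real integrable_bdd_meas_mult by auto
  have comb: "integral {a..c} f + integral {c..x} f = integral {a..x} f"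
    if "f integrable_on {a..b}" "x \<in> {c..d}" for f :: "real \<Rightarrow> real" and x
    using that assms by (intro Henstock_Kurzweil_Integration.integral_combine) (auto intro: integrable_on_subinterval)
  show ?thesis unfolding solves_def
  proof (intro conjI ballI)
    show "continuous_on {c..d} u" "continuous_on {c..d} w"
      using s assms by (auto intro: continuous_on_subset)
    fix x assume x: "x \<in> {c..d}"
    then have m: "x \<in> {a..b}" "c \<in> {a..b}" using assms by auto
    show "u x = u c + integral {c..x} w"
      using comb[OF i(1) x] u[OF m(1)] u[OF m(2)] by linarith
    show "w x = w c + integral {c..x} (\<lambda>t. q t * u t)"
      using comb[OF i(2) x] w[OF m(1)] w[OF m(2)] by linarith
  qed
qed

lemma solves_linear:
  assumes "solves q a b u w" "solves q a b u' w'" "bdd_meas q"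
  shows "solves q a b (\<lambda>x. c * u x + c' * u' x) (\<lambda>x. c * w x + c' * w' x)"
proof -
  have s: "continuous_on {a..b} u" "continuous_on {a..b} w"
     "continuous_on {a..b} u'" "continuous_on {a..b} w'"
    using solvesD(1,2)[OF assms(1)] solvesD(1,2)[OF assms(2)] .
  show ?thesis unfolding solves_def
  proof (intro conjI ballI)
    show "continuous_on {a..b} (\<lambda>x. c * u x + c' * u' x)"
         "continuous_on {a..b} (\<lambda>x. c * w x + c' * w' x)"
      using s by (auto intro!: continuous_intros)
    fix x assume x: "x \<in> {a..b}"
    have c: "continuous_on {a..x} u" "continuous_on {a..x} w"
      "continuous_on {a..x} u'" "continuous_on {a..x} w'"
      using s x by (auto intro: continuous_on_subset)
    have i: "w integrable_on {a..x}" "(\<lambda>t. q t * u t) integrable_on {a..x}"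
        "w' integrable_on {a..x}" "(\<lambda>t. q t * u' t) integrable_on {a..x}"
      using c assms(3) integrable_continuous_real integrable_bdd_meas_mult by auto
    have "((\<lambda>x. c * w x + c' * w' x) has_integral c * integral {a..x} w + c' * integral {a..x} w') {a..x}"
      using i by (intro has_integral_add has_integral_mult_right) (auto simp: has_integral_iff)
    moreover have "u x = u a + integral {a..x} w" "u' x = u' a + integral {a..x} w'"
      using assms x unfolding solves_def by blast+
    ultimately show "c * u x + c' * u' x = c * u a + c' * u' a + integral {a..x} (\<lambda>x. c * w x + c' * w' x)"
      by (simp add: integral_unique algebra_simps)
    have "((\<lambda>x. c * (q x * u x) + c' * (q x * u' x)) has_integral
        c * integral {a..x} (\<lambda>x. q x * u x) + c' * integral {a..x} (\<lambda>x. q x * u' x)) {a..x}"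
      using i by (intro has_integral_add has_integral_mult_right) (auto simp: has_integral_iff)
    then have "integral {a..x} (\<lambda>x. q x * (c * u x + c' * u' x)) =
        c * integral {a..x} (\<lambda>x. q x * u x) + c' * integral {a..x} (\<lambda>x. q x * u' x)"
      by (simp add: integral_unique algebra_simps)
    moreover have "w x = w a + integral {a..x} (\<lambda>x. q x * u x)"
      "w' x = w' a + integral {a..x} (\<lambda>x. q x * u' x)"
      using assms x unfolding solves_def by blast+
    ultimately show "c * w x + c' * w' x =
        c * w a + c' * w' a + integral {a..x} (\<lambda>x. q x * (c * u x + c' * u' x))"
      by (simp add: algebra_simps)
  qed
qed

lemma solves_sin:
  "solves (\<lambda>_. - k\<^sup>2) a b (\<lambda>x. sin (k * x + c)) (\<lambda>x. k * cos (k * x + c))"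
  unfolding solves_def
proof (intro conjI ballI)
  fix x assume "x \<in> {a..b}"
  then have ax: "a \<le> x" by simp
  have "((\<lambda>x. k * cos (k * x + c)) has_integral sin (k * x + c) - sin (k * a + c)) {a..x}"
    using ax by (intro fundamental_theorem_of_calculus)
      (auto simp: has_real_derivative_iff_has_vector_derivative[symmetric] intro!: derivative_eq_intros)
  then show "sin (k * x + c) = sin (k * a + c) + integral {a..x} (\<lambda>x. k * cos (k * x + c))"
    by (simp only: integral_unique)
  have "((\<lambda>x. - k\<^sup>2 * sin (k * x + c)) has_integral k * cos (k * x + c) - k * cos (k * a + c)) {a..x}"
    using ax by (intro fundamental_theorem_of_calculus)
      (auto simp: has_real_derivative_iff_has_vector_derivative[symmetric] power2_eq_square
        intro!: derivative_eq_intros)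
  then show "k * cos (k * x + c) = k * cos (k * a + c) + integral {a..x} (\<lambda>x. - k\<^sup>2 * sin (k * x + c))"
    by (simp only: integral_unique)
qed (auto intro!: continuous_intros)

lemma solves_product_rule:
  assumes "solves q a b u w" "bdd_meas q" "a \<le> b"
    and "\<And>x. x \<in> {a..b} \<Longrightarrow> (\<phi> has_real_derivative \<phi>' x) (at x within {a..b})"
    and "continuous_on {a..b} \<phi>'"
  shows "((\<lambda>x. q x * u x * \<phi> x + w x * \<phi>' x) has_integral (w b * \<phi> b - w a * \<phi> a)) {a..b}"
  by (rule product_rule[OF assms(2) solvesD(1)[OF assms(1)] assms(3) solvesD(4)[OF assms(1)] assms(4,5)])

text \<open>Lagrange's identity: each solution is the test function in the product rule for the
  other, and the terms \<open>w * r\<close> cancel in the difference.\<close>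

lemma wronskian_integral:
  assumes s: "solves q a b u w" "solves p a b s r" and q: "bdd_meas q" "bdd_meas p"
    and cd: "a \<le> c" "c \<le> d" "d \<le> b"
  shows "((\<lambda>x. (q x - p x) * (u x * s x)) has_integral
           (w d * s d - u d * r d) - (w c * s c - u c * r c)) {c..d}"
proof -
  have 1: "solves q c d u w" "solves p c d s r"
    using solves_subinterval[OF s(1) q(1) cd] solves_subinterval[OF s(2) q(2) cd] .
  have "((\<lambda>x. q x * u x * s x + w x * r x) has_integral (w d * s d - w c * s c)) {c..d}"
    using 1 q cd by (intro solves_product_rule solves_deriv solvesD(2))
  moreover have "((\<lambda>x. p x * s x * u x + r x * w x) has_integral (r d * u d - r c * u c)) {c..d}"
    using 1 q cd by (intro solves_product_rule solves_deriv solvesD(2))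
  ultimately have "((\<lambda>x. (q x * u x * s x + w x * r x) - (p x * s x * u x + r x * w x)) has_integral
     (w d * s d - w c * s c) - (r d * u d - r c * u c)) {c..d}"
    by (rule has_integral_diff)
  then show ?thesis
    by (simp add: algebra_simps)
qed

section \<open>Sturm comparison\<close>

text \<open>By Lagrange's identity the increment is the integral of
  \<open>(q - p) * (u * s)\<close>. This integrand is merely measurable, so strictness is taken from
  its continuous minorant \<open>e * (u * s)\<close>, which is positive inside the interval.\<close>

lemma wronskian_strict_mono:
  assumes s: "solves q a b u w" "solves p a b s r" and q: "bdd_meas q" "bdd_meas p"
    and cd: "a \<le> c" "c < d" "d \<le> b"
    and e: "e > 0" "\<And>x. x \<in> {c..d} \<Longrightarrow> e \<le> q x - p x"
    and pos: "\<And>x. x \<in> {c<..<d} \<Longrightarrow> u x > 0" "\<And>x. x \<in> {c<..<d} \<Longrightarrow> s x > 0"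
  shows "w c * s c - u c * r c < w d * s d - u d * r d"
proof -
  have cu: "continuous_on {c..d} u" "continuous_on {c..d} s"
    using solvesD(1)[OF s(1)] solvesD(1)[OF s(2)] cd by (auto intro: continuous_on_subset)
  have "0 \<le> u x" "0 \<le> s x" if "x \<in> {c..d}" for x
    using continuous_ge_on_closure[of "{c<..<d}" u x 0] continuous_ge_on_closure[of "{c<..<d}" s x 0]
      cu pos that cd by (auto simp: less_imp_le)
  then have le: "e * (u x * s x) \<le> (q x - p x) * (u x * s x)" if "x \<in> {c..d}" for x
    using e(2)[OF that] that by (intro mult_right_mono) auto
  have hi: "((\<lambda>x. e * (u x * s x)) has_integral integral {c..d} (\<lambda>x. e * (u x * s x))) {c..d}"
    using cu by (intro integrable_integral integrable_continuous_real continuous_intros)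
  have "integral {c..d} (\<lambda>x. e * (u x * s x)) \<le> (w d * s d - u d * r d) - (w c * s c - u c * r c)"
    by (rule has_integral_le[OF hi wronskian_integral[OF s q cd(1) less_imp_le[OF cd(2)] cd(3)] le])
  moreover have "integral {c..d} (\<lambda>x. 0) < integral {c..d} (\<lambda>x. e * (u x * s x))"
    using cd e pos cu by (intro integral_less_real continuous_intros) auto
  ultimately show ?thesis by simp
qed

text \<open>Comparison with the sine whose consecutive zeros are \<open>c\<close> and
  \<open>d\<close>: the Wronskian is \<open>k * u c\<close> at \<open>c\<close> and
  \<open>- k * u d\<close> at \<open>d\<close>, so its strict increase contradicts
  \<open>u \<ge> 0\<close> at both ends.\<close>

lemma sturm_no_positive:
  assumes s: "solves q c d u w" "bdd_meas q" "c < d"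
    and m: "\<And>x. x \<in> {c..d} \<Longrightarrow> q x \<le> - m" "(pi / (d - c))\<^sup>2 < m"
    and pos: "\<And>x. x \<in> {c<..<d} \<Longrightarrow> u x > 0"
  shows False
proof -
  define k where "k = pi / (d - c)"
  have k: "k > 0" "k * (d - c) = pi" using s(3) by (auto simp: k_def)
  have sp: "0 < sin (k * x + - (k * c))" if "x \<in> {c<..<d}" for x
  proof (rule sin_gt_zero)
    show "0 < k * x + - (k * c)" using that k by auto
    have "k * (x - c) < pi" using mult_strict_left_mono[of "x - c" "d - c" k] that k by simp
    then show "k * x + - (k * c) < pi" using k by (simp add: algebra_simps)
  qed
  have kd: "k * d - k * c = pi" using k by (simp add: algebra_simps)
  have "k * cos (k * c + - (k * c)) * u c - sin (k * c + - (k * c)) * w c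
      < k * cos (k * d + - (k * c)) * u d - sin (k * d + - (k * c)) * w d"
  proof (rule wronskian_strict_mono[OF solves_sin s(1), where e = "m - k\<^sup>2"])
    show "m - k\<^sup>2 \<le> - k\<^sup>2 - q x" if "x \<in> {c..d}" for x using m(1)[OF that] by simp
  qed (use s m pos sp in \<open>auto simp: k_def\<close>)
  then have "k * (u c + u d) < 0"
    using kd by (simp add: algebra_simps)
  moreover have "0 \<le> u x" if "x \<in> {c..d}" for x
    using continuous_ge_on_closure[of "{c<..<d}" u x 0] solvesD(1)[OF s(1)] pos that s(3)
    by (auto simp: less_imp_le)
  then have "0 \<le> u c + u d" using s(3) by (intro add_nonneg_nonneg) auto
  ultimately show False using k by (auto simp: mult_less_0_iff)
qed

text \<open>Without a zero the solution has constant sign by connectedness. As \<open>- u\<close> is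
  a solution too, \<open>sturm_no_positive\<close> excludes both signs.\<close>

lemma sturm_zero:
  assumes s: "solves q c d u w" "bdd_meas q" "c < d"
    and m: "\<And>x. x \<in> {c..d} \<Longrightarrow> q x \<le> - m" "(pi / (d - c))\<^sup>2 < m"
  shows "\<exists>x\<in>{c<..<d}. u x = 0"
proof (rule ccontr)
  assume no: "\<not> ?thesis"
  have con: "connected (u ` {c<..<d})"
    using solvesD(1)[OF s(1)] by (intro connected_continuous_image) (auto intro: continuous_on_subset)
  from connectedD_interval[OF con, of _ _ 0] no
  have "(\<forall>x\<in>{c<..<d}. u x > 0) \<or> (\<forall>x\<in>{c<..<d}. u x < 0)"
    by (smt (verit) imageE imageI)
  then show False
  proof
    assume "\<forall>x\<in>{c<..<d}. u x > 0"
    then show False using sturm_no_positive[OF s m] by auto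
  next
    assume *: "\<forall>x\<in>{c<..<d}. u x < 0"
    have "solves q c d (\<lambda>x. (-1) * u x + 0 * u x) (\<lambda>x. (-1) * w x + 0 * w x)"
      using solves_linear[OF s(1) s(1) s(2)] .
    then show False using * by (intro sturm_no_positive[OF _ s(2,3) m]) auto
  qed
qed

text \<open>The ends are the last zero before \<open>x0\<close> and the first zero after it, which
  exist by compactness. A nonpositive value between them would produce a zero closer to
  \<open>x0\<close>.\<close>

lemma nodal_interval:
  fixes u :: "real \<Rightarrow> real"
  assumes u: "continuous_on {a..b} u" "u a = 0" "u b = 0" and x0: "x0 \<in> {a..b}" "u x0 > 0"
  obtains \<alpha> \<beta> where "a \<le> \<alpha>" "\<alpha> < \<beta>" "\<beta> \<le> b" "u \<alpha> = 0" "u \<beta> = 0"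
    "\<And>x. x \<in> {\<alpha><..<\<beta>} \<Longrightarrow> u x > 0"
proof -
  have cl: "closed {x \<in> {a..b}. u x = 0}"
    using continuous_closed_preimage_constant[OF u(1)] by simp
  define A B where "A = {x \<in> {a..b}. u x = 0} \<inter> {a..x0}" and "B = {x \<in> {a..b}. u x = 0} \<inter> {x0..b}"
  have c: "compact A" "compact B"
    unfolding A_def B_def using cl by (auto intro: closed_Int_compact)
  have "a \<in> A" "b \<in> B"
    unfolding A_def B_def using u x0 by auto
  then have ne: "A \<noteq> {}" "B \<noteq> {}" by auto
  obtain \<alpha> where \<alpha>: "\<alpha> \<in> A" "\<And>x. x \<in> A \<Longrightarrow> x \<le> \<alpha>"
    using compact_attains_sup[OF c(1) ne(1)] by blast
  obtain \<beta> where \<beta>: "\<beta> \<in> B" "\<And>x. x \<in> B \<Longrightarrow> \<beta> \<le> x"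
    using compact_attains_inf[OF c(2) ne(2)] by blast
  note \<alpha> = \<alpha>[unfolded A_def] and \<beta> = \<beta>[unfolded B_def]
  have "u x > 0" if x: "x \<in> {\<alpha><..<\<beta>}" for x
  proof (rule ccontr)
    assume neg: "\<not> u x > 0"
    have sub: "continuous_on {x..x0} u" "continuous_on {x0..x} u"
      using u(1) \<alpha>(1) \<beta>(1) x x0 by (auto intro: continuous_on_subset)
    show False
    proof (cases "x \<le> x0")
      case True
      obtain z where "x \<le> z" "z \<le> x0" "u z = 0"
        using IVT'[of u x 0 x0] neg x0 True sub by auto
      then show False using \<alpha>(2)[of z] x \<alpha>(1) x0 by auto
    next
      case False
      obtain z where "x0 \<le> z" "z \<le> x" "u z = 0"
        using IVT2'[of u x 0 x0] neg x0 False sub by auto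
      then show False using \<beta>(2)[of z] x \<beta>(1) x0 by auto
    qed
  qed
  moreover have "\<alpha> < \<beta>"
    using \<alpha>(1) \<beta>(1) x0 by (cases "\<alpha> = x0") auto
  ultimately show ?thesis using that \<alpha>(1) \<beta>(1) by auto
qed

text \<open>At the ends of a nodal interval a Wronskian \<open>w * s - u * r\<close> reduces to
  \<open>w * s\<close>, whose sign is controlled by these inequalities.\<close>

lemma nodal_deriv_sign:
  fixes u :: "real \<Rightarrow> real"
  assumes "a \<le> \<alpha>" "\<alpha> < \<beta>" "\<beta> \<le> b" "u \<alpha> = 0" "u \<beta> = 0" "\<And>x. x \<in> {\<alpha><..<\<beta>} \<Longrightarrow> u x > 0"
    and d: "\<And>x. x \<in> {a..b} \<Longrightarrow> (u has_real_derivative w x) (at x within {a..b})"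
  shows "w \<alpha> \<ge> 0" "w \<beta> \<le> 0"
proof -
  show "w \<alpha> \<ge> 0"
  proof (rule ccontr)
    assume "\<not> w \<alpha> \<ge> 0"
    then obtain e where e: "e > 0" "\<And>h. h > 0 \<Longrightarrow> \<alpha> + h \<in> {a..b} \<Longrightarrow> h < e \<Longrightarrow> u \<alpha> > u (\<alpha> + h)"
      using has_real_derivative_neg_dec_right[OF d[of \<alpha>]] assms by auto
    define h where "h = min (e/2) ((\<beta> - \<alpha>)/2)"
    have "h > 0" "h < e" "h < \<beta> - \<alpha>" using e(1) assms(2) by (auto simp: h_def min_def)
    then show False using e(2)[of h] assms(1-5) assms(6)[of "\<alpha> + h"] by auto
  qed
  show "w \<beta> \<le> 0"
  proof (rule ccontr)
    assume "\<not> w \<beta> \<le> 0"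
    then obtain e where e: "e > 0" "\<And>h. h > 0 \<Longrightarrow> \<beta> - h \<in> {a..b} \<Longrightarrow> h < e \<Longrightarrow> u (\<beta> - h) < u \<beta>"
      using has_real_derivative_pos_inc_left[OF d[of \<beta>]] assms by auto
    define h where "h = min (e/2) ((\<beta> - \<alpha>)/2)"
    have "h > 0" "h < e" "h < \<beta> - \<alpha>" using e(1) assms(2) by (auto simp: h_def min_def)
    then show False using e(2)[of h] assms(1-5) assms(6)[of "\<beta> - h"] by auto
  qed
qed

text \<open>By the Riccati equation for \<open>w / u\<close>, the integral of \<open>v\<close> is
  the increment of \<open>w / u\<close> plus the integral of \<open>\<mu> + (w / u)\<^sup>2\<close>.
  Both are estimated through \<open>\<bar>w / u\<bar> \<le> k / \<sigma>\<close> on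
  \<open>[-R, R]\<close>. For fixed \<open>R\<close> and \<open>\<sigma>\<close> the resulting bound
  tends to 0 with \<open>k\<close>.\<close>

lemma integral_potential_bound:
  assumes v: "bdd_meas v" "\<And>x. 0 \<le> v x" and R: "0 < R" "R < b" and \<sigma>: "\<sigma> > 0" and k: "k > 0" "\<mu> < k\<^sup>2"
    and s0: "\<And>x. - b < x \<Longrightarrow> x \<le> R \<Longrightarrow> 0 < sin (k * (b + x))"
    and s\<sigma>: "\<And>x. x \<in> {-R..R} \<Longrightarrow> \<sigma> \<le> sin (k * (b + x))"
    and s: "solves (\<lambda>x. v x - \<mu>) (-b) b u w" "u (-b) = 0" "u b = 0"
    and x0: "x0 \<in> {-b..b}" "u x0 > 0"
  shows "integral {-R..R} v \<le> 2 * k / \<sigma> + 2 * R * (k\<^sup>2 + (k / \<sigma>)\<^sup>2)"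
proof -
  define q where "q = (\<lambda>x. v x - \<mu>)"
  have q: "bdd_meas q" unfolding q_def using v by (intro bdd_meas_diff) auto
  have sq: "solves q (-b) b u w" using s(1) by (simp add: q_def)
  obtain \<alpha> \<beta> where ab: "-b \<le> \<alpha>" "\<alpha> < \<beta>" "\<beta> \<le> b" "u \<alpha> = 0" "u \<beta> = 0"
    and pos: "\<And>x. x \<in> {\<alpha><..<\<beta>} \<Longrightarrow> u x > 0"
    using nodal_interval[OF solvesD(1)[OF sq] s(2,3) x0] by blast
  have w: "w \<alpha> \<ge> 0" "w \<beta> \<le> 0"
    using nodal_deriv_sign[OF ab pos solves_deriv[OF sq]] by auto
  \<comment> \<open>\<open>s1\<close> vanishes at \<open>-b\<close> and \<open>s2\<close> at
    \<open>b\<close>. They are mirror images, so the hypotheses on \<open>sin (k * (b + x))\<close>,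
    read at \<open>-x\<close>, control \<open>s2\<close>.\<close>
  define s1 r1 where "s1 = (\<lambda>x. sin (k * x + k * b))" and "r1 = (\<lambda>x. k * cos (k * x + k * b))"
  define s2 r2 where "s2 = (\<lambda>x. sin ((-k) * x + k * b))" and "r2 = (\<lambda>x. (-k) * cos ((-k) * x + k * b))"
  have sol1: "solves (\<lambda>_. - k\<^sup>2) (-b) b s1 r1" unfolding s1_def r1_def by (rule solves_sin)
  have sol2: "solves (\<lambda>_. - k\<^sup>2) (-b) b s2 r2" unfolding s2_def r2_def
    using solves_sin[of "-k"] by simp
  have s1: "s1 x = sin (k * (b + x))" "s2 x = sin (k * (b + (- x)))" for x
    by (simp_all add: s1_def s2_def algebra_simps)
  have s1p: "s1 x > 0" if "-b < x" "x \<le> R" for x using s0[of x] that by (simp add: s1)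
  have s2p: "s2 x > 0" if "-R \<le> x" "x < b" for x using s0[of "-x"] that by (simp add: s1)
  have e: "k\<^sup>2 - \<mu> > 0" "k\<^sup>2 - \<mu> \<le> q x - (- k\<^sup>2)" for x
    using k v(2)[of x] by (auto simp: q_def)
  have mono1: "w c * s1 c - u c * r1 c < w d * s1 d - u d * r1 d"
    if "\<alpha> \<le> c" "c < d" "d \<le> \<beta>" "d \<le> R" for c d
    using that ab s1p pos
    by (intro wronskian_strict_mono[OF sq sol1 q _ _ _ _ e]) auto
  have mono2: "w c * s2 c - u c * r2 c < w d * s2 d - u d * r2 d"
    if "\<alpha> \<le> c" "c < d" "d \<le> \<beta>" "-R \<le> c" for c d
    using that ab s2p pos
    by (intro wronskian_strict_mono[OF sq sol2 q _ _ _ _ e]) auto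
  have s1nn: "s1 \<alpha> \<ge> 0" if "\<alpha> \<le> R" using s1p[of \<alpha>] that ab(1)
    by (cases "\<alpha> = -b") (auto simp: s1)
  have s2nn: "s2 \<beta> \<ge> 0" if "-R \<le> \<beta>" using s2p[of \<beta>] that ab(3)
    by (cases "\<beta> = b") (auto simp: s1)
  \<comment> \<open>If the nodal interval ended at or before \<open>R\<close>, the Wronskian with
    \<open>s1\<close> would increase strictly from a nonnegative value at \<open>\<alpha>\<close> to
    a nonpositive one at \<open>\<beta>\<close>. The bound on \<open>\<alpha>\<close> below is the
    mirror image with \<open>s2\<close>.\<close>
  have \<beta>R: "R < \<beta>"
  proof (rule ccontr)
    assume "\<not> R < \<beta>"
    then have "w \<alpha> * s1 \<alpha> < w \<beta> * s1 \<beta>" "s1 \<alpha> \<ge> 0" "s1 \<beta> > 0"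
      using mono1[of \<alpha> \<beta>] ab s1nn s1p[of \<beta>] by auto
    moreover from this have "0 \<le> w \<alpha> * s1 \<alpha>" "w \<beta> * s1 \<beta> \<le> 0"
      using w by (simp_all add: mult_nonpos_nonneg)
    ultimately show False by linarith
  qed
  have \<alpha>R: "\<alpha> < -R"
  proof (rule ccontr)
    assume "\<not> \<alpha> < -R"
    then have "w \<alpha> * s2 \<alpha> < w \<beta> * s2 \<beta>" "s2 \<alpha> > 0" "s2 \<beta> \<ge> 0"
      using mono2[of \<alpha> \<beta>] ab s2nn s2p[of \<alpha>] by auto
    moreover from this have "0 \<le> w \<alpha> * s2 \<alpha>" "w \<beta> * s2 \<beta> \<le> 0"
      using w by (simp_all add: mult_nonpos_nonneg)
    ultimately show False by linarith
  qed
  have up: "u x > 0" if "x \<in> {-R..R}" for x using pos[of x] that \<alpha>R \<beta>R by auto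
  \<comment> \<open>Trades the bound \<open>k\<close> on the derivatives of the sines for a multiple
    of the sines themselves, which can then be divided out.\<close>
  have ks: "k \<le> (k / \<sigma>) * t" if "\<sigma> \<le> t" for t
    using that \<sigma> k by (simp add: field_simps)
  \<comment> \<open>The growth of the Wronskian with \<open>s1\<close> from \<open>\<alpha>\<close>
    to \<open>x\<close> bounds \<open>w / u\<close> from below; with \<open>s2\<close> from
    \<open>x\<close> to \<open>\<beta>\<close> it bounds \<open>w / u\<close> from above.\<close>
  have \<rho>: "\<bar>w x / u x\<bar> \<le> k / \<sigma>" if x: "x \<in> {-R..R}" for x
  proof -
    have ux: "u x > 0" using up[OF x] .
    have "0 \<le> w \<alpha> * s1 \<alpha>" using w s1nn \<alpha>R R by simp
    also have "\<dots> < w x * s1 x - u x * r1 x"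
      using mono1[of \<alpha> x] \<alpha>R \<beta>R x ab by auto
    also have "\<dots> \<le> w x * s1 x + u x * k"
    proof -
      have "- k \<le> r1 x" using k cos_ge_minus_one[of "k * x + k * b"] mult_left_mono[of "-1" "cos (k * x + k * b)" k]
        by (auto simp: r1_def)
      then show ?thesis using ux mult_left_mono[of "-k" "r1 x" "u x"] by auto
    qed
    also have "\<dots> \<le> w x * s1 x + u x * ((k / \<sigma>) * s1 x)"
      using mult_left_mono[OF ks[OF s\<sigma>[OF x]] less_imp_le[OF ux]] by (simp add: s1)
    also have "\<dots> = s1 x * (w x + u x * (k / \<sigma>))" by (simp add: algebra_simps)
    finally have "0 < w x + u x * (k / \<sigma>)"
      using s1p[of x] x R by (auto simp: zero_less_mult_iff)
    then have 1: "- (k / \<sigma>) \<le> w x / u x" using ux by (simp add: field_simps)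
    have "w x * s2 x - u x * k \<le> w x * s2 x - u x * r2 x"
    proof -
      have "r2 x \<le> k" using k cos_ge_minus_one[of "(-k) * x + k * b"] mult_left_mono[of "-1" "cos ((-k) * x + k * b)" k]
        by (auto simp: r2_def)
      then show ?thesis using ux mult_left_mono[of "r2 x" k "u x"] by auto
    qed
    also have "\<dots> < w \<beta> * s2 \<beta>"
      using mono2[of x \<beta>] \<alpha>R \<beta>R x ab by auto
    also have "\<dots> \<le> 0" using w s2nn \<beta>R R by (auto intro: mult_nonpos_nonneg)
    finally have "w x * s2 x < u x * k" by simp
    also have "\<dots> \<le> u x * ((k / \<sigma>) * s2 x)"
      using mult_left_mono[OF ks[OF s\<sigma>[of "-x"]] less_imp_le[OF ux]] x by (simp add: s1)
    finally have "0 < s2 x * (u x * (k / \<sigma>) - w x)" by (simp add: algebra_simps)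
    then have "0 < u x * (k / \<sigma>) - w x"
      using s2p[of x] x R by (auto simp: zero_less_mult_iff)
    then have "w x / u x \<le> k / \<sigma>" using ux by (simp add: field_simps)
    with 1 show ?thesis by auto
  qed
  have sR: "solves q (-R) R u w" using solves_subinterval[OF sq q] R by auto
  \<comment> \<open>The test function \<open>1 / u\<close> yields the Riccati equation in integrated
    form, without differentiating \<open>w\<close>.\<close>
  have der: "((\<lambda>x. inverse (u x)) has_real_derivative - w x / (u x)\<^sup>2) (at x within {-R..R})" if "x \<in> {-R..R}" for x
    using solves_deriv[OF sR that] up[OF that]
    by (auto intro!: derivative_eq_intros simp: power2_eq_square field_simps)
  have cont: "continuous_on {-R..R} u" "continuous_on {-R..R} w" using solvesD[OF sR] by auto
  have c2: "continuous_on {-R..R} (\<lambda>x. - w x / (u x)\<^sup>2)" "continuous_on {-R..R} (\<lambda>x. \<mu> + (w x / u x)\<^sup>2)"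
    using cont up by (auto intro!: continuous_intros) force+
  have "((\<lambda>x. q x * u x * inverse (u x) + w x * (- w x / (u x)\<^sup>2)) has_integral
          (w R * inverse (u R) - w (-R) * inverse (u (-R)))) {-R..R}"
    using R by (intro solves_product_rule[OF sR q _ der c2(1)]) auto
  then have "((\<lambda>x. q x * u x * inverse (u x) + w x * (- w x / (u x)\<^sup>2) + (\<mu> + (w x / u x)\<^sup>2)) has_integral
          (w R * inverse (u R) - w (-R) * inverse (u (-R))) + integral {-R..R} (\<lambda>x. \<mu> + (w x / u x)\<^sup>2)) {-R..R}"
    by (intro has_integral_add integrable_integral integrable_continuous_real c2)
  moreover have "q x * u x * inverse (u x) + w x * (- w x / (u x)\<^sup>2) + (\<mu> + (w x / u x)\<^sup>2) = v x" if "x \<in> {-R..R}" for x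
    using up[OF that] by (simp add: q_def power2_eq_square field_simps)
  ultimately have vi: "(v has_integral
          (w R * inverse (u R) - w (-R) * inverse (u (-R))) + integral {-R..R} (\<lambda>x. \<mu> + (w x / u x)\<^sup>2)) {-R..R}"
    by (rule has_integral_eq[rotated])
  have "integral {-R..R} v = w R / u R - w (-R) / u (-R) + integral {-R..R} (\<lambda>x. \<mu> + (w x / u x)\<^sup>2)"
    unfolding integral_unique[OF vi] by (simp add: divide_inverse)
  moreover have "integral {-R..R} (\<lambda>x. \<mu> + (w x / u x)\<^sup>2) \<le> integral {-R..R} (\<lambda>x. k\<^sup>2 + (k / \<sigma>)\<^sup>2)"
  proof (rule integral_le)
    fix x assume "x \<in> {-R..R}"
    then have "\<bar>w x / u x\<bar>\<^sup>2 \<le> (k / \<sigma>)\<^sup>2" using \<rho> by (intro power_mono) auto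
    then have "(w x / u x)\<^sup>2 \<le> (k / \<sigma>)\<^sup>2" by (simp only: power2_abs)
    with k(2) show "\<mu> + (w x / u x)\<^sup>2 \<le> k\<^sup>2 + (k / \<sigma>)\<^sup>2" by linarith
  qed (intro integrable_continuous_real c2 continuous_on_const)+
  moreover have "integral {-R..R} (\<lambda>x. k\<^sup>2 + (k / \<sigma>)\<^sup>2) = 2 * R * (k\<^sup>2 + (k / \<sigma>)\<^sup>2)" using R by simp
  moreover have "\<bar>w R / u R\<bar> \<le> k / \<sigma>" "\<bar>w (-R) / u (-R)\<bar> \<le> k / \<sigma>"
    using \<rho>[of R] \<rho>[of "-R"] R by (simp_all del: abs_divide)
  ultimately have "integral {-R..R} v \<le> k / \<sigma> + k / \<sigma> + 2 * R * (k\<^sup>2 + (k / \<sigma>)\<^sup>2)"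
    unfolding abs_le_iff by linarith
  then show ?thesis by simp
qed

section \<open>The initial value problem\<close>

lemma continuous_on_Icc_bounded:
  fixes f :: "real \<Rightarrow> real"
  assumes "continuous_on {a..b} f"
  obtains M where "\<And>x. x \<in> {a..b} \<Longrightarrow> \<bar>f x\<bar> \<le> M"
proof -
  have "bounded (f ` {a..b})"
    using assms by (auto intro: compact_imp_bounded compact_continuous_image)
  then obtain M where "\<forall>x\<in>{a..b}. \<bar>f x\<bar> \<le> M"
    unfolding bounded_iff by auto
  then show ?thesis using that by blast
qed

text \<open>The \<open>n\<close>-th term of the Picard series for \<open>u\<close> is bounded by
  \<open>M * (K * (b - a)) ^ n / fact n\<close>, which gives uniform convergence. Dominated
  convergence then moves the limit through the integrals, including those with the merely measurable
  factor \<open>q\<close>.\<close>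

lemma exists_solution:
  assumes q: "bdd_meas q" and ab: "a \<le> b"
  shows "\<exists>u w. solves q a b u w \<and> u a = c0 \<and> w a = c1"
proof -
  obtain Q where Q: "Q > 0" "\<And>x. \<bar>q x\<bar> \<le> Q" using bdd_meas_bound[OF q] by blast
  define V where "V = (\<lambda>f x. integral {a..x} (\<lambda>t. q t * f t) :: real)"
  \<comment> \<open>Picard series: \<open>u\<close> and \<open>w\<close> are the sums of \<open>U n\<close> and of \<open>W n\<close>.\<close>
  define U where "U = rec_nat (\<lambda>x. c0 + c1 * (x - a)) (\<lambda>_ f x. integral {a..x} (V f))"
  define W where "W = (\<lambda>n. case n of 0 \<Rightarrow> (\<lambda>_. c1) | Suc m \<Rightarrow> V (U m))"
  have U0: "U 0 = (\<lambda>x. c0 + c1 * (x - a))" and US: "U (Suc n) = (\<lambda>x. integral {a..x} (V (U n)))" for n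
    by (simp_all add: U_def)
  have W0: "W 0 = (\<lambda>_. c1)" and WS: "W (Suc n) = V (U n)" for n
    by (simp_all add: W_def)
  have Vc: "continuous_on {a..b} (V f)" if "continuous_on {a..b} f" for f
    unfolding V_def by (intro indefinite_integral_continuous_1 integrable_bdd_meas_mult q that)
  have Uc: "continuous_on {a..b} (U n)" for n
    by (induction n) (auto simp: U0 US intro!: continuous_intros indefinite_integral_continuous_1
          integrable_continuous_real Vc)
  have Wc: "continuous_on {a..b} (W n)" for n
    by (cases n) (auto simp: W0 WS intro!: Vc Uc)
  have sub: "continuous_on {a..x} f" if "continuous_on {a..b} f" "x \<in> {a..b}" for f :: "real \<Rightarrow> real" and x
    using that by (auto intro: continuous_on_subset)
  define M where "M = \<bar>c0\<bar> + \<bar>c1\<bar> * (b - a)"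
  define K where "K = Q * (b - a)"
  have K: "K \<ge> 0" "M \<ge> 0" using Q ab by (auto simp: K_def M_def)
  define p where "p = (\<lambda>n x. (K * (x - a)) ^ n / fact n)"
  \<comment> \<open>Of the two integrations per Picard step, this one is estimated crudely by the
    length of the interval. Only the other one gains the factor
    \<open>K * (x - a) / (n + 1)\<close>, which suffices for summability.\<close>
  have VU: "\<bar>V (U n) x\<bar> \<le> K * M * p n x"
    if x: "x \<in> {a..b}" and IH: "\<And>x. x \<in> {a..b} \<Longrightarrow> \<bar>U n x\<bar> \<le> M * p n x" for n x
  proof -
    have "\<bar>q t * U n t\<bar> \<le> Q * (M * p n x)" if t: "t \<in> {a..x}" for t
    proof -
      have "p n t \<le> p n x"
        unfolding p_def using t K by (intro divide_right_mono power_mono mult_left_mono) auto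
      then have "\<bar>U n t\<bar> \<le> M * p n x"
        using IH[of t] t x K by (auto intro: order_trans mult_left_mono)
      then show ?thesis unfolding abs_mult using Q by (intro mult_mono) auto
    qed
    then have "\<bar>V (U n) x\<bar> \<le> Q * (M * p n x) * (x - a)"
      unfolding V_def using x by (intro abs_integral_le integrable_bdd_meas_mult q sub[OF Uc]) auto
    also have "\<dots> \<le> Q * (M * p n x) * (b - a)"
      using x K Q by (intro mult_left_mono) (auto simp: p_def)
    finally show ?thesis by (simp add: K_def mult_ac)
  qed
  have Ub: "\<bar>U n x\<bar> \<le> M * p n x" if "x \<in> {a..b}" for n x
    using that
  proof (induction n arbitrary: x)
    case 0
    have "\<bar>c1 * (x - a)\<bar> \<le> \<bar>c1\<bar> * (b - a)"
      unfolding abs_mult using 0 by (intro mult_left_mono) auto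
    then show ?case by (simp add: U0 M_def p_def)
  next
    case (Suc n)
    have d: "((\<lambda>x. K * M * p n x) has_integral M * p (Suc n) x - M * p (Suc n) a) {a..x}"
    proof (rule fundamental_theorem_of_calculus)
      fix t assume "t \<in> {a..x}"
      show "((\<lambda>x. M * p (Suc n) x) has_vector_derivative K * M * p n t) (at t within {a..x})"
      proof -
        have "((\<lambda>x. K * (x - a)) has_real_derivative K) (at t within {a..x})"
          by (auto intro!: derivative_eq_intros)
        from DERIV_cmult[OF DERIV_power_Suc[OF this, of n], of "M / fact (Suc n)"]
        have "((\<lambda>x. M * p (Suc n) x) has_real_derivative
            M / fact (Suc n) * ((1 + real n) * (K * (K * (t - a)) ^ n))) (at t within {a..x})"
          by (simp add: p_def)
        also have "M / fact (Suc n) * ((1 + real n) * (K * (K * (t - a)) ^ n)) = K * M * p n t"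
          by (simp add: p_def divide_simps)
        finally show ?thesis by (simp add: has_real_derivative_iff_has_vector_derivative)
      qed
    qed (use Suc in auto)
    have "norm (U (Suc n) x) \<le> integral {a..x} (\<lambda>x. K * M * p n x)"
      unfolding US
    proof (rule integral_norm_bound_integral)
      show "V (U n) integrable_on {a..x}"
        using Suc by (intro integrable_continuous_real sub[OF Vc[OF Uc]])
      fix t assume "t \<in> {a..x}"
      then show "norm (V (U n) t) \<le> K * M * p n t"
        using VU[OF _ Suc.IH, of t] Suc.prems by auto
    qed (use d in \<open>auto simp: has_integral_iff\<close>)
    also have "\<dots> = M * p (Suc n) x"
      using integral_unique[OF d] by (simp add: p_def)
    finally show ?case by simp
  qed
  define m where "m = (\<lambda>n. (K * (b - a)) ^ n / fact n)"
  have pm: "p n x \<le> m n" if "x \<in> {a..b}" for n x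
    unfolding p_def m_def using that K by (intro divide_right_mono power_mono mult_left_mono) auto
  have summ: "summable m"
    using summable_exp[of "K * (b - a)"] unfolding m_def by (simp add: divide_inverse mult.commute)
  have Um: "\<bar>U n x\<bar> \<le> M * m n" if "x \<in> {a..b}" for n x
    using Ub[OF that, of n] mult_left_mono[OF pm[OF that, of n] K(2)] by simp
  have Wm: "\<bar>W (Suc n) x\<bar> \<le> K * M * m n" if "x \<in> {a..b}" for n x
    using VU[OF that Ub, of n] mult_left_mono[OF pm[OF that, of n], of "K * M"] K by (simp add: WS)
  \<comment> \<open>The majorants for \<open>W\<close> are shifted by one index because
    \<open>W (Suc n)\<close> is built from \<open>U n\<close>.\<close>
  define wm where "wm = (\<lambda>n. case n of 0 \<Rightarrow> \<bar>c1\<bar> | Suc k \<Rightarrow> K * M * m k)"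
  have Wm': "\<bar>W n x\<bar> \<le> wm n" if "x \<in> {a..b}" for n x
    using Wm[OF that] by (cases n) (auto simp: wm_def W0)
  have swm: "summable wm"
    using summable_mult[OF summ, of "K * M"] by (subst summable_Suc_iff[symmetric]) (simp add: wm_def)
  have sUm: "summable (\<lambda>n. M * m n)" using summable_mult[OF summ] .
  define u where "u = (\<lambda>x. \<Sum>n. U n x)"
  define w where "w = (\<lambda>x. \<Sum>n. W n x)"
  have ul: "uniform_limit {a..b} (\<lambda>n x. \<Sum>i<n. U i x) u sequentially"
    unfolding u_def by (rule Weierstrass_m_test[OF _ sUm]) (simp only: real_norm_def Um)
  have wl: "uniform_limit {a..b} (\<lambda>n x. \<Sum>i<n. W i x) w sequentially"
    unfolding w_def by (rule Weierstrass_m_test[OF _ swm]) (simp only: real_norm_def Wm')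
  have uc: "continuous_on {a..b} u" and wc: "continuous_on {a..b} w"
    by (rule uniform_limit_theorem[OF _ ul] uniform_limit_theorem[OF _ wl];
        auto intro!: always_eventually continuous_intros Uc Wc)+
  have ut: "(\<lambda>n. \<Sum>i<n. U i x) \<longlonglongrightarrow> u x" if "x \<in> {a..b}" for x
    using tendsto_uniform_limitI[OF ul that] .
  have wt: "(\<lambda>n. \<Sum>i<n. W i x) \<longlonglongrightarrow> w x" if "x \<in> {a..b}" for x
    using tendsto_uniform_limitI[OF wl that] .
  have bd: "\<bar>\<Sum>i<n. f i\<bar> \<le> suminf g" if "\<And>i. \<bar>f i\<bar> \<le> g i" "summable g" for f g :: "nat \<Rightarrow> real" and n
  proof -
    have "\<bar>\<Sum>i<n. f i\<bar> \<le> (\<Sum>i<n. g i)"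
      using that(1) by (intro order_trans[OF sum_abs] sum_mono) auto
    also have "\<dots> \<le> suminf g" using that order_trans[OF abs_ge_zero that(1)] by (intro sum_le_suminf) auto
    finally show ?thesis .
  qed
  have limU: "(\<lambda>n. integral {a..x} (\<lambda>t. q t * (\<Sum>i<n. U i t))) \<longlonglongrightarrow> V u x" if x: "x \<in> {a..b}" for x
    unfolding V_def
  proof (rule dominated_convergence(2))
    show "(\<lambda>t. q t * (\<Sum>i<n. U i t)) integrable_on {a..x}" for n
      by (intro integrable_bdd_meas_mult q continuous_on_sum sub[OF Uc x])
    show "(\<lambda>_. Q * (\<Sum>n. M * m n)) integrable_on {a..x}" by (rule integrable_const_ivl)
    fix t assume t: "t \<in> {a..x}"
    show "norm (q t * (\<Sum>i<n. U i t)) \<le> Q * (\<Sum>n. M * m n)" for n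
      unfolding real_norm_def abs_mult
      using Q t x by (intro mult_mono bd Um sUm) auto
    show "(\<lambda>n. q t * (\<Sum>i<n. U i t)) \<longlonglongrightarrow> q t * u t"
      using t x by (intro tendsto_mult_left ut) auto
  qed
  have limW: "(\<lambda>n. integral {a..x} (\<lambda>t. \<Sum>i<n. W i t)) \<longlonglongrightarrow> integral {a..x} w" if x: "x \<in> {a..b}" for x
  proof (rule dominated_convergence(2))
    show "(\<lambda>t. \<Sum>i<n. W i t) integrable_on {a..x}" for n
      by (intro integrable_continuous_real continuous_on_sum sub[OF Wc x])
    show "(\<lambda>_. \<Sum>n. wm n) integrable_on {a..x}" by (rule integrable_const_ivl)
    fix t assume t: "t \<in> {a..x}"
    show "norm (\<Sum>i<n. W i t) \<le> (\<Sum>n. wm n)" for n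
      unfolding real_norm_def using t x by (intro bd Wm' swm) auto
    show "(\<lambda>n. \<Sum>i<n. W i t) \<longlonglongrightarrow> w t"
      using t x by (intro wt) auto
  qed
  have UW: "U n x = (if n = 0 then c0 else 0) + integral {a..x} (W n)" if "x \<in> {a..b}" for n x
    using that by (cases n) (auto simp: U0 US W0 WS mult.commute)
  have u_eq: "u x = c0 + integral {a..x} w" if x: "x \<in> {a..b}" for x
  proof -
    have "(\<Sum>i<Suc n. U i x) = c0 + integral {a..x} (\<lambda>t. \<Sum>i<Suc n. W i t)" for n
    proof -
      have "(\<Sum>i<Suc n. U i x) = (\<Sum>i<Suc n. if i = 0 then c0 else 0) + (\<Sum>i<Suc n. integral {a..x} (W i))"
        by (simp only: UW[OF x] sum.distrib)
      also have "(\<Sum>i<Suc n. integral {a..x} (W i)) = integral {a..x} (\<lambda>t. \<Sum>i<Suc n. W i t)"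
        by (rule integral_sum[symmetric]) (auto intro!: integrable_continuous_real sub[OF Wc x])
      finally show ?thesis by (simp del: sum.lessThan_Suc)
    qed
    then have "(\<lambda>n. \<Sum>i<Suc n. U i x) \<longlonglongrightarrow> c0 + integral {a..x} w"
      using tendsto_add[OF tendsto_const LIMSEQ_Suc[OF limW[OF x]], of c0] by simp
    with LIMSEQ_Suc[OF ut[OF x]] show ?thesis by (rule LIMSEQ_unique)
  qed
  have w_eq: "w x = c1 + V u x" if x: "x \<in> {a..b}" for x
  proof -
    have "(\<Sum>i<Suc n. W i x) = c1 + integral {a..x} (\<lambda>t. q t * (\<Sum>i<n. U i t))" for n
    proof -
      have "(\<Sum>i<Suc n. W i x) = c1 + (\<Sum>i<n. integral {a..x} (\<lambda>t. q t * U i t))"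
        by (simp add: sum.lessThan_Suc_shift W0 WS V_def del: sum.lessThan_Suc)
      also have "(\<Sum>i<n. integral {a..x} (\<lambda>t. q t * U i t)) = integral {a..x} (\<lambda>t. \<Sum>i<n. q t * U i t)"
        by (rule integral_sum[symmetric]) (auto intro!: integrable_bdd_meas_mult q sub[OF Uc x])
      finally show ?thesis by (simp add: sum_distrib_left)
    qed
    then have "(\<lambda>n. \<Sum>i<Suc n. W i x) \<longlonglongrightarrow> c1 + V u x"
      using tendsto_add[OF tendsto_const limU[OF x], of c1] by simp
    with LIMSEQ_Suc[OF wt[OF x]] show ?thesis by (rule LIMSEQ_unique)
  qed
  have "u a = c0" "w a = c1" using u_eq[of a] w_eq[of a] ab by (auto simp: V_def)
  moreover have "u x = u a + integral {a..x} w" "w x = w a + integral {a..x} (\<lambda>t. q t * u t)"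
    if x: "x \<in> {a..b}" for x
    using u_eq[OF x] w_eq[OF x] \<open>u a = c0\<close> \<open>w a = c1\<close> by (simp_all add: V_def)
  then have "solves q a b u w"
    using uc wc unfolding solves_def by blast
  ultimately show ?thesis by blast
qed

text \<open>The right-hand side \<open>G\<close> of the integral inequality has derivative
  \<open>K * N \<le> K * G\<close>, so \<open>G x * exp (- (K * (x - a)))\<close> is
  nonincreasing.\<close>

lemma gronwall:
  fixes N :: "real \<Rightarrow> real"
  assumes N: "continuous_on {a..b} N" and K: "K \<ge> 0" and x: "x \<in> {a..b}"
    and le: "\<And>x. x \<in> {a..b} \<Longrightarrow> N x \<le> c + K * integral {a..x} N"
  shows "N x \<le> c * exp (K * (x - a))"
proof -
  define G where "G = (\<lambda>x. c + K * integral {a..x} N)"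
  define H where "H = (\<lambda>x. G x * exp (- (K * (x - a))))"
  have dH: "(H has_real_derivative K * (N y - G y) * exp (- (K * (y - a)))) (at y within {a..b})"
    if "y \<in> {a..b}" for y
    unfolding H_def G_def using integral_has_real_derivative[OF N that]
    by (auto intro!: derivative_eq_intros simp: algebra_simps)
  have "H x \<le> H a"
  proof (rule DERIV_nonpos_imp_decreasing_open[where f = H and a = a and b = x])
    show "a \<le> x" using x by simp
    have "continuous_on {a..b} H"
      using dH by (meson DERIV_continuous continuous_on_eq_continuous_within)
    then show "continuous_on {a..x} H" using x by (auto intro: continuous_on_subset)
    fix y assume y: "a < y" "y < x"
    then have "K * (N y - G y) * exp (- (K * (y - a))) \<le> 0"
      using le[of y] x K by (intro mult_nonpos_nonneg mult_nonneg_nonpos) (auto simp: G_def)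
    moreover have "at y within {a..b} = at y" using y x by (intro at_within_Icc_at) auto
    ultimately show "\<exists>d. (H has_real_derivative d) (at y) \<and> d \<le> 0"
      using dH[of y] y x by auto
  qed
  then have "G x * exp (- (K * (x - a))) \<le> c" by (simp add: H_def G_def)
  then have "G x * exp (- (K * (x - a))) * exp (K * (x - a)) \<le> c * exp (K * (x - a))"
    by (rule mult_right_mono) simp
  then have "G x \<le> c * exp (K * (x - a))"
    unfolding mult.assoc exp_add[symmetric] by simp
  with le[OF x] show ?thesis by (simp add: G_def)
qed

text \<open>Gronwall's inequality for the sum of both differences, after splitting
  \<open>q1 * u1 - q2 * u2\<close> as \<open>q1 * (u1 - u2) + (q1 - q2) * u2\<close>. The case
  \<open>e = 0\<close> is uniqueness; small \<open>e\<close> gives continuity in the energy.\<close>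

lemma solves_perturbation:
  assumes s1: "solves q1 a b u1 w1" and s2: "solves q2 a b u2 w2" and q: "bdd_meas q1" "bdd_meas q2"
    and init: "u1 a = u2 a" "w1 a = w2 a"
    and Q: "\<And>x. \<bar>q1 x\<bar> \<le> Q" and e: "\<And>x. \<bar>q1 x - q2 x\<bar> \<le> e"
    and M: "\<And>x. x \<in> {a..b} \<Longrightarrow> \<bar>u2 x\<bar> \<le> M" and x: "x \<in> {a..b}"
  shows "\<bar>u1 x - u2 x\<bar> + \<bar>w1 x - w2 x\<bar> \<le> e * M * (b - a) * exp ((1 + Q) * (b - a))"
proof -
  have nn: "0 \<le> Q" "0 \<le> e" "0 \<le> M"
    using Q e M[OF x] by (meson abs_ge_zero order_trans)+
  define N where "N = (\<lambda>x. \<bar>u1 x - u2 x\<bar> + \<bar>w1 x - w2 x\<bar>)"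
  have c: "continuous_on {a..b} u1" "continuous_on {a..b} w1" "continuous_on {a..b} u2" "continuous_on {a..b} w2"
    using solvesD(1,2)[OF s1] solvesD(1,2)[OF s2] .
  have Nc: "continuous_on {a..b} N" unfolding N_def by (intro continuous_intros c)
  have "N x \<le> e * M * (b - a) * exp ((1 + Q) * (x - a))"
  proof (rule gronwall[OF Nc _ x])
    fix y assume y: "y \<in> {a..b}"
    have cy: "continuous_on {a..y} u1" "continuous_on {a..y} w1" "continuous_on {a..y} u2" "continuous_on {a..y} w2"
        "continuous_on {a..y} N"
      using c Nc y by (auto intro: continuous_on_subset)
    have i: "w1 integrable_on {a..y}" "w2 integrable_on {a..y}" "N integrable_on {a..y}"
      "(\<lambda>t. q1 t * u1 t) integrable_on {a..y}" "(\<lambda>t. q2 t * u2 t) integrable_on {a..y}"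
      by (intro integrable_continuous_real integrable_bdd_meas_mult q cy)+
    have "u1 y - u2 y = integral {a..y} w1 - integral {a..y} w2"
      using solvesD(3)[OF s1 y] solvesD(3)[OF s2 y] init by linarith
    also have "\<dots> = integral {a..y} (\<lambda>t. w1 t - w2 t)"
      using i by (simp add: integral_diff)
    also have "norm \<dots> \<le> integral {a..y} N"
      using i by (intro integral_norm_bound_integral integrable_diff) (auto simp: N_def)
    finally have 1: "\<bar>u1 y - u2 y\<bar> \<le> integral {a..y} N" by simp
    have "w1 y - w2 y = integral {a..y} (\<lambda>t. q1 t * u1 t) - integral {a..y} (\<lambda>t. q2 t * u2 t)"
      using solvesD(4)[OF s1 y] solvesD(4)[OF s2 y] init by linarith
    also have "\<dots> = integral {a..y} (\<lambda>t. q1 t * u1 t - q2 t * u2 t)"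
      using i by (simp add: integral_diff)
    also have "norm \<dots> \<le> integral {a..y} (\<lambda>t. Q * N t + e * M)"
    proof (rule integral_norm_bound_integral)
      fix t assume t: "t \<in> {a..y}"
      have "q1 t * u1 t - q2 t * u2 t = q1 t * (u1 t - u2 t) + (q1 t - q2 t) * u2 t"
        by (simp add: algebra_simps)
      also have "norm \<dots> \<le> \<bar>q1 t\<bar> * \<bar>u1 t - u2 t\<bar> + \<bar>q1 t - q2 t\<bar> * \<bar>u2 t\<bar>"
        by (metis abs_mult norm_triangle_ineq real_norm_def)
      also have "\<dots> \<le> Q * N t + e * M"
        using Q[of t] e[of t] M[of t] t y nn by (intro add_mono mult_mono) (auto simp: N_def)
      finally show "norm (q1 t * u1 t - q2 t * u2 t) \<le> Q * N t + e * M" .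
    next
      show "(\<lambda>t. q1 t * u1 t - q2 t * u2 t) integrable_on {a..y}"
        using i by (intro integrable_diff)
      show "(\<lambda>t. Q * N t + e * M) integrable_on {a..y}"
        by (intro integrable_continuous_real continuous_intros cy)
    qed
    also have "\<dots> = Q * integral {a..y} N + e * M * (y - a)"
      using i y by (subst integral_add) (auto intro!: integrable_continuous_real continuous_intros cy)
    also have "\<dots> \<le> Q * integral {a..y} N + e * M * (b - a)"
      using y nn by (intro add_left_mono mult_left_mono) auto
    finally show "N y \<le> e * M * (b - a) + (1 + Q) * integral {a..y} N"
      using 1 by (simp add: N_def algebra_simps)
  qed (use nn in auto)
  also have "\<dots> \<le> e * M * (b - a) * exp ((1 + Q) * (b - a))"
    using nn x by (intro mult_left_mono) (auto intro!: mult_left_mono mult_nonneg_nonneg)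
  finally show ?thesis by (simp add: N_def)
qed

lemma solves_unique:
  assumes s: "solves q a b u1 w1" "solves q a b u2 w2" and q: "bdd_meas q"
    and init: "u1 a = u2 a" "w1 a = w2 a" and x: "x \<in> {a..b}"
  shows "u1 x = u2 x" "w1 x = w2 x"
proof -
  obtain Q where Q: "\<And>x. \<bar>q x\<bar> \<le> Q" using bdd_meas_bound[OF q] by blast
  obtain M where "\<And>x. x \<in> {a..b} \<Longrightarrow> \<bar>u2 x\<bar> \<le> M"
    using continuous_on_Icc_bounded[OF solvesD(1)[OF s(2)]] by blast
  then have "\<bar>u1 x - u2 x\<bar> + \<bar>w1 x - w2 x\<bar> \<le> 0 * M * (b - a) * exp ((1 + Q) * (b - a))"
    by (intro solves_perturbation[OF s q q init Q _ _ x]) auto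
  then show "u1 x = u2 x" "w1 x = w2 x" by auto
qed

text \<open>Uniqueness is available only forward from \<open>a\<close>. Instead, the Wronskian with
  the solution whose initial data are rotated by a right angle is constant and equals
  \<open>- ((u a)\<^sup>2 + (w a)\<^sup>2)\<close>, so \<open>u\<close> and \<open>w\<close> cannot
  vanish together.\<close>

lemma solves_nonvanishing:
  assumes s: "solves q a b u w" and q: "bdd_meas q" and ne: "u a \<noteq> 0 \<or> w a \<noteq> 0" and x: "x \<in> {a..b}"
  shows "u x \<noteq> 0 \<or> w x \<noteq> 0"
proof -
  have "a \<le> b" using x by auto
  then obtain y r where y: "solves q a b y r" "y a = - w a" "r a = u a"
    using exists_solution[OF q] by blast
  have "((\<lambda>x. (q x - q x) * (u x * y x)) has_integral
           (w x * y x - u x * r x) - (w a * y a - u a * r a)) {a..x}"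
    using x by (intro wronskian_integral[OF s y(1) q q]) auto
  then have "w x * y x - u x * r x = w a * y a - u a * r a"
    by (auto dest: has_integral_unique[OF has_integral_0])
  also have "\<dots> = - ((u a)\<^sup>2 + (w a)\<^sup>2)" using y by (simp add: power2_eq_square)
  also have "\<dots> \<noteq> 0" using ne unfolding neg_equal_0_iff_equal sum_power2_eq_zero_iff by blast
  finally show ?thesis by auto
qed

text \<open>Joint continuity: the perturbation bound compares energies \<open>E\<close> and
  \<open>E'\<close> at the same position, uniformly in the position, and continuity of the single
  solution at \<open>E'\<close> handles the change of position.\<close>

lemma solves_continuous_in_energy:
  assumes v: "bdd_meas v"
    and s: "\<And>E. E \<in> S \<Longrightarrow> solves (\<lambda>x. v x - E) a b (U E) (W E)"
    and init: "\<And>E. E \<in> S \<Longrightarrow> U E a = c0" "\<And>E. E \<in> S \<Longrightarrow> W E a = c1"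
  shows "continuous_on ({a..b} \<times> S) (\<lambda>z. U (snd z) (fst z))"
    and "continuous_on ({a..b} \<times> S) (\<lambda>z. W (snd z) (fst z))"
proof -
  obtain B where B: "\<And>x. \<bar>v x\<bar> \<le> B" using bdd_meas_bound[OF v] by blast
  have bE: "bdd_meas (\<lambda>x. v x - E)" for E using bdd_meas_diff[OF v] by simp
  have "((\<lambda>z. U (snd z) (fst z)) \<longlongrightarrow> U E' x') (at (x', E') within {a..b} \<times> S) \<and>
        ((\<lambda>z. W (snd z) (fst z)) \<longlongrightarrow> W E' x') (at (x', E') within {a..b} \<times> S)"
    if x': "x' \<in> {a..b}" and E': "E' \<in> S" for x' E'
  proof -
    let ?F = "at (x', E') within {a..b} \<times> S"
    obtain M where M: "\<And>x. x \<in> {a..b} \<Longrightarrow> \<bar>U E' x\<bar> \<le> M"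
      using continuous_on_Icc_bounded[OF solvesD(1)[OF s[OF E']]] by blast
    define k where "k = (\<lambda>E. \<bar>E - E'\<bar> * M * (b - a) * exp ((1 + (B + \<bar>E\<bar>)) * (b - a)))"
    have bd: "\<bar>U E x - U E' x\<bar> + \<bar>W E x - W E' x\<bar> \<le> k E" if "E \<in> S" "x \<in> {a..b}" for E x
      unfolding k_def
    proof (rule solves_perturbation[OF s[OF that(1)] s[OF E'] bE bE])
      show "\<bar>v x - E\<bar> \<le> B + \<bar>E\<bar>" for x using B[of x] by linarith
    qed (use init that E' M in auto)
    have lim: "((\<lambda>z. snd z) \<longlongrightarrow> E') ?F" "((\<lambda>z. fst z) \<longlongrightarrow> x') ?F"
      by (auto intro!: tendsto_eq_intros)
    have "((\<lambda>z. k (snd z)) \<longlongrightarrow> \<bar>E' - E'\<bar> * M * (b - a) * exp ((1 + (B + \<bar>E'\<bar>)) * (b - a))) ?F"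
      unfolding k_def by (intro tendsto_intros lim)
    then have k0: "((\<lambda>z. k (snd z)) \<longlongrightarrow> 0) ?F" by simp
    have ev: "\<forall>\<^sub>F z in ?F. fst z \<in> {a..b} \<and> snd z \<in> S"
      by (auto simp: eventually_at_filter intro!: always_eventually)
    have d: "((\<lambda>z. U (snd z) (fst z) - U E' (fst z)) \<longlongrightarrow> 0) ?F"
            "((\<lambda>z. W (snd z) (fst z) - W E' (fst z)) \<longlongrightarrow> 0) ?F"
      by (rule Lim_null_comparison[OF eventually_mono[OF ev] k0]; use bd in force)+
    have c: "((\<lambda>z. f (fst z)) \<longlongrightarrow> f x') ?F" if "continuous_on {a..b} f" for f :: "real \<Rightarrow> real"
    proof -
      have "continuous_on ({a..b} \<times> S) (\<lambda>z. f (fst z))"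
        by (rule continuous_on_compose2[OF that]) (auto intro!: continuous_intros)
      then show ?thesis using x' E' unfolding continuous_on_def by fastforce
    qed
    show ?thesis
      using tendsto_add[OF d(1) c[OF solvesD(1)[OF s[OF E']]]]
        tendsto_add[OF d(2) c[OF solvesD(2)[OF s[OF E']]]] by simp
  qed
  then show "continuous_on ({a..b} \<times> S) (\<lambda>z. U (snd z) (fst z))"
    and "continuous_on ({a..b} \<times> S) (\<lambda>z. W (snd z) (fst z))"
    unfolding continuous_on_def by auto
qed

section \<open>Shooting\<close>

text \<open>Energy identity: testing the equation with \<open>u\<close> itself makes the integral of
  \<open>q * u\<^sup>2 + w\<^sup>2\<close> vanish, so the continuous function \<open>w\<close> is
  zero. At energy 0 this keeps the Pruefer angle from reaching \<open>pi\<close>.\<close>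

lemma dirichlet_solution_of_nonneg:
  assumes s: "solves q a b u w" and q: "bdd_meas q" "\<And>x. 0 \<le> q x"
    and x0: "a < x0" "x0 \<le> b" "u a = 0" "u x0 = 0"
  shows "w a = 0"
proof -
  have s0: "solves q a x0 u w" using solves_subinterval[OF s q(1)] x0 by auto
  have wc: "continuous_on {a..x0} (\<lambda>x. (w x)\<^sup>2)" by (intro continuous_intros solvesD(2)[OF s0])
  have "((\<lambda>x. q x * u x * u x + w x * w x) has_integral (w x0 * u x0 - w a * u a)) {a..x0}"
    using x0 by (intro solves_product_rule[OF s0 q(1)] solves_deriv[OF s0] solvesD(2)[OF s0]) auto
  then have i: "((\<lambda>x. q x * u x * u x + w x * w x) has_integral 0) {a..x0}" using x0 by simp
  have "integral {a..x0} (\<lambda>x. (w x)\<^sup>2) \<le> 0"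
  proof (rule has_integral_le[OF integrable_integral[OF integrable_continuous_real[OF wc]] i])
    fix x show "(w x)\<^sup>2 \<le> q x * u x * u x + w x * w x"
      using q(2)[of x] by (simp add: power2_eq_square mult.assoc)
  qed
  moreover have "integral {a..x0} (\<lambda>x. (w x)\<^sup>2) \<ge> 0"
    by (intro integral_nonneg integrable_continuous_real wc) auto
  ultimately have "\<forall>x\<in>{a..x0}. (w x)\<^sup>2 = 0"
    using integral_eq_0_iff[OF wc] x0 by auto
  then show ?thesis using x0 by auto
qed

text \<open>
  At a zero of \<open>u\<close> the derivative of \<open>u\<close> has the sign of \<open>cos \<theta>\<close>, so \<open>\<theta>\<close> can only cross the multiples
  of \<open>\<pi>\<close> upwards.
\<close>

lemma prufer_crossing:
  fixes u w \<theta> \<rho> :: "real \<Rightarrow> real" and n :: nat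
  assumes \<theta>: "continuous_on {a..b} \<theta>"
    and \<rho>: "\<And>x. x \<in> {a..b} \<Longrightarrow> \<rho> x > 0"
    and u: "\<And>x. x \<in> {a..b} \<Longrightarrow> u x = \<rho> x * sin (\<theta> x)"
    and w: "\<And>x. x \<in> {a..b} \<Longrightarrow> w x = \<rho> x * cos (\<theta> x)"
    and d: "\<And>x. x \<in> {a..b} \<Longrightarrow> (u has_real_derivative w x) (at x within {a..b})"
    and xy: "a \<le> x" "x < y" "y \<le> b" and ge: "\<theta> x \<ge> real n * pi"
  shows "\<theta> y > real n * pi"
proof -
  \<comment> \<open>The sign \<open>(-1) ^ n\<close> makes \<open>h\<close> increasing at every
    point where \<open>\<theta>\<close> equals \<open>n * pi\<close>, whatever the parity of
    \<open>n\<close>.\<close>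
  define h where "h = (\<lambda>x. (-1) ^ n * u x)"
  have h: "h t = \<rho> t * sin (\<theta> t - real n * pi)" if "t \<in> {a..b}" for t
    using u[OF that] by (simp add: h_def sin_diff)
  have dh: "(h has_real_derivative (-1) ^ n * w t) (at t within {a..b})" if "t \<in> {a..b}" for t
    unfolding h_def using d[OF that] by (rule DERIV_cmult)
  have dpos: "(-1) ^ n * w t > 0" "h t = 0" if "t \<in> {a..b}" "\<theta> t = real n * pi" for t
    using \<rho>[OF that(1)] w[OF that(1)] h[OF that(1)] that(2) by (cases "even n"; auto)+
  \<comment> \<open>While \<open>\<theta> s\<close> is within \<open>pi\<close> of
    \<open>n * pi\<close>, the sign of \<open>sin (\<theta> s - n * pi)\<close> shows on which side
    of \<open>n * pi\<close> it lies.\<close>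
  have near: "\<exists>e>0. \<forall>s\<in>{a..b}. \<bar>s - t\<bar> < e \<longrightarrow> \<bar>\<theta> s - \<theta> t\<bar> < pi" if "t \<in> {a..b}" for t
    using \<theta> that pi_gt_zero unfolding continuous_on_iff dist_real_def by blast
  have left: "\<exists>e>0. \<forall>s\<in>{a..b}. t - e < s \<longrightarrow> s < t \<longrightarrow> \<theta> s < real n * pi"
    if t: "t \<in> {a..b}" "\<theta> t = real n * pi" for t
  proof -
    obtain e1 where e1: "e1 > 0" "\<And>k. k > 0 \<Longrightarrow> t - k \<in> {a..b} \<Longrightarrow> k < e1 \<Longrightarrow> h (t - k) < h t"
      using has_real_derivative_pos_inc_left[OF dh[OF t(1)] dpos(1)[OF t]] by auto
    obtain e2 where e2: "e2 > 0" "\<forall>s\<in>{a..b}. \<bar>s - t\<bar> < e2 \<longrightarrow> \<bar>\<theta> s - \<theta> t\<bar> < pi"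
      using near[OF t(1)] by blast
    have "\<theta> s < real n * pi" if s: "s \<in> {a..b}" "t - min e1 e2 < s" "s < t" for s
    proof (rule ccontr)
      assume "\<not> \<theta> s < real n * pi"
      moreover have "\<bar>\<theta> s - real n * pi\<bar> < pi" using e2(2) s t by auto
      ultimately have "sin (\<theta> s - real n * pi) \<ge> 0" by (intro sin_ge_zero) auto
      then have "h s \<ge> 0" using h[OF s(1)] \<rho>[OF s(1)] by simp
      moreover have "h s < 0" using e1(2)[of "t - s"] s dpos(2)[OF t] by auto
      ultimately show False by simp
    qed
    then show ?thesis using e1(1) e2(1) by (intro exI[of _ "min e1 e2"]) auto
  qed
  have right: "\<exists>e>0. \<forall>s\<in>{a..b}. t < s \<longrightarrow> s < t + e \<longrightarrow> \<theta> s > real n * pi"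
    if t: "t \<in> {a..b}" "\<theta> t = real n * pi" for t
  proof -
    obtain e1 where e1: "e1 > 0" "\<And>k. k > 0 \<Longrightarrow> t + k \<in> {a..b} \<Longrightarrow> k < e1 \<Longrightarrow> h t < h (t + k)"
      using has_real_derivative_pos_inc_right[OF dh[OF t(1)] dpos(1)[OF t]] by auto
    obtain e2 where e2: "e2 > 0" "\<forall>s\<in>{a..b}. \<bar>s - t\<bar> < e2 \<longrightarrow> \<bar>\<theta> s - \<theta> t\<bar> < pi"
      using near[OF t(1)] by blast
    have "\<theta> s > real n * pi" if s: "s \<in> {a..b}" "s < t + min e1 e2" "t < s" for s
    proof (rule ccontr)
      assume "\<not> \<theta> s > real n * pi"
      moreover have "\<bar>\<theta> s - real n * pi\<bar> < pi" using e2(2) s t by auto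
      ultimately have "sin (real n * pi - \<theta> s) \<ge> 0" by (intro sin_ge_zero) auto
      then have "sin (\<theta> s - real n * pi) \<le> 0" using sin_minus[of "\<theta> s - real n * pi"] by simp
      then have "h s \<le> 0" using h[OF s(1)] \<rho>[OF s(1)] by (simp add: mult_nonneg_nonpos)
      moreover have "h s > 0" using e1(2)[of "s - t"] s dpos(2)[OF t] by auto
      ultimately show False by simp
    qed
    then show ?thesis using e1(1) e2(1) by (intro exI[of _ "min e1 e2"]) auto
  qed
  obtain x' where x': "x \<le> x'" "x' < y" "\<theta> x' > real n * pi"
  proof (cases "\<theta> x = real n * pi")
    case True
    then obtain e where e: "e > 0" "\<forall>s\<in>{a..b}. x < s \<longrightarrow> s < x + e \<longrightarrow> \<theta> s > real n * pi"
      using right[of x] xy by auto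
    show ?thesis
      using e(2)[THEN bspec, of "x + min (e/2) ((y - x)/2)"] e(1) xy
      by (intro that[of "x + min (e/2) ((y - x)/2)"]) (auto simp: min_def field_simps)
  qed (use ge xy that[of x] in auto)
  show ?thesis
  proof (rule ccontr)
    assume "\<not> \<theta> y > real n * pi"
    then have "y \<in> {t \<in> {x'..y}. \<theta> t \<in> {..real n * pi}}" (is "_ \<in> ?S") using x' by auto
    moreover have "compact ?S"
    proof -
      have "continuous_on {x'..y} \<theta>" using \<theta> x' xy by (auto intro: continuous_on_subset)
      then have "closed ({x'..y} \<inter> \<theta> -` {..real n * pi})"
        by (intro continuous_closed_preimage) auto
      moreover have "?S = {x'..y} \<inter> ({x'..y} \<inter> \<theta> -` {..real n * pi})" by auto
      ultimately show ?thesis by (metis compact_Icc compact_Int_closed)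
    qed
    \<comment> \<open>\<open>s\<close> is the first point after \<open>x'\<close> at which
      \<open>\<theta>\<close> is no longer above \<open>n * pi\<close>. There
      \<open>\<theta>\<close> equals \<open>n * pi\<close>, so \<open>left\<close> puts it below
      \<open>n * pi\<close> just before \<open>s\<close>, against the minimality of
      \<open>s\<close>.\<close>
    ultimately obtain s where s: "s \<in> ?S" "\<And>t. t \<in> ?S \<Longrightarrow> s \<le> t"
      using compact_attains_inf[of ?S] by blast
    have "x' < s" using s(1) x'(3) by (cases "s = x'") auto
    have above: "\<theta> t > real n * pi" if "x' \<le> t" "t < s" for t
      using s(2)[of t] that s(1) by force
    have "\<theta> s = real n * pi"
    proof (rule ccontr)
      assume "\<theta> s \<noteq> real n * pi"
      then have "\<theta> s < real n * pi" using s(1) by auto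
      moreover have "continuous_on {x'..s} \<theta>" using \<theta> x' xy s(1) by (auto intro: continuous_on_subset)
      ultimately obtain t where "x' \<le> t" "t \<le> s" "\<theta> t = real n * pi"
        using IVT2'[of \<theta> s "real n * pi" x'] x' \<open>x' < s\<close> by auto
      then show False using above[of t] \<open>\<theta> s \<noteq> real n * pi\<close> by (cases "t = s") auto
    qed
    then obtain e where e: "e > 0" "\<forall>t\<in>{a..b}. s - e < t \<longrightarrow> t < s \<longrightarrow> \<theta> t < real n * pi"
      using left[of s] s(1) x' xy by auto
    have "\<theta> (max x' (s - e/2)) < real n * pi"
      using e s(1) x' xy \<open>x' < s\<close> by (intro e(2)[rule_format]) (auto simp: max_def)
    moreover have "\<theta> (max x' (s - e/2)) > real n * pi"
      using e(1) \<open>x' < s\<close> by (intro above) auto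
    ultimately show False by simp
  qed
qed

text \<open>
  The Pruefer angle is the imaginary part of a continuous logarithm of \<open>u' + \<i> u\<close>, as a function of
  position and energy, on a contractible rectangle.
\<close>

lemma shooting:
  assumes v: "bdd_meas v" "\<And>x. 0 \<le> v x" and ab: "a < b" and E1: "0 \<le> E1"
    and zeros: "\<And>u w. solves (\<lambda>x. v x - E1) a b u w \<Longrightarrow>
                 \<exists>x1 x2. a < x1 \<and> x1 < x2 \<and> x2 < b \<and> u x1 = 0 \<and> u x2 = 0"
  shows "\<exists>E E'. E \<noteq> E' \<and> E \<le> E1 \<and> E' \<le> E1 \<and>
    (\<exists>u w. solves (\<lambda>x. v x - E) a b u w \<and> u a = 0 \<and> w a = 1 \<and> u b = 0) \<and>
    (\<exists>u w. solves (\<lambda>x. v x - E') a b u w \<and> u a = 0 \<and> w a = 1 \<and> u b = 0)"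
proof -
  have q: "bdd_meas (\<lambda>x. v x - E)" for E using v by (intro bdd_meas_diff) auto
  have "\<forall>E. \<exists>p. solves (\<lambda>x. v x - E) a b (fst p) (snd p) \<and> fst p a = 0 \<and> snd p a = 1"
    using exists_solution[OF q less_imp_le[OF ab], of _ 0 1] by simp
  then obtain P where P: "\<And>E. solves (\<lambda>x. v x - E) a b (fst (P E)) (snd (P E))"
      "\<And>E. fst (P E) a = 0" "\<And>E. snd (P E) a = 1"
    using choice[of "\<lambda>E p. solves (\<lambda>x. v x - E) a b (fst p) (snd p) \<and> fst p a = 0 \<and> snd p a = 1"] by auto
  define U W where "U = (\<lambda>E. fst (P E))" and "W = (\<lambda>E. snd (P E))"
  have sol: "solves (\<lambda>x. v x - E) a b (U E) (W E)" and init: "U E a = 0" "W E a = 1" for E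
    using P by (simp_all add: U_def W_def)
  define D where "D = {a..b} \<times> {0..E1}"
  define Z where "Z = (\<lambda>z. Complex (W (snd z) (fst z)) (U (snd z) (fst z)))"
  have contZ: "continuous_on D Z"
    unfolding Z_def D_def Complex_eq
    by (intro continuous_intros solves_continuous_in_energy[OF v(1) sol init])
  have "contractible D"
    unfolding D_def by (intro convex_imp_contractible convex_Times) auto
  moreover have "Z z \<noteq> 0" if "z \<in> D" for z
    using solves_nonvanishing[OF sol q, of "snd z" "fst z"] init that
    by (auto simp: Z_def D_def complex_eq_iff)
  ultimately obtain g where g: "continuous_on D g" "\<And>z. z \<in> D \<Longrightarrow> Z z = exp (g z)"
    using continuous_logarithm_on_contractible[OF contZ] by metis
  \<comment> \<open>The initial data give \<open>Z = 1\<close> at \<open>x = a\<close>, so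
    subtracting \<open>g (a, E)\<close> leaves a logarithm of \<open>Z\<close> and normalises the
    angle to 0 at \<open>a\<close> for every energy.\<close>
  define h where "h = (\<lambda>E x. g (x, E) - g (a, E))"
  define \<theta> where "\<theta> = (\<lambda>E x. Im (h E x))"
  have expa: "exp (g (a, E)) = 1" if "E \<in> {0..E1}" for E
    using g(2)[of "(a, E)"] that ab init by (auto simp: Z_def D_def Complex_eq)
  have Zh: "Complex (W E x) (U E x) = exp (h E x)" if "E \<in> {0..E1}" "x \<in> {a..b}" for E x
    using g(2)[of "(x, E)"] that expa[of E] by (auto simp: Z_def D_def h_def exp_diff)
  have polar: "U E x = exp (Re (h E x)) * sin (\<theta> E x)" "W E x = exp (Re (h E x)) * cos (\<theta> E x)"
    if "E \<in> {0..E1}" "x \<in> {a..b}" for E x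
    using arg_cong[OF Zh[OF that], of Im] arg_cong[OF Zh[OF that], of Re]
    by (simp_all add: Re_exp Im_exp \<theta>_def)
  have cont\<theta>: "continuous_on {a..b} (\<theta> E)" if "E \<in> {0..E1}" for E
    unfolding \<theta>_def h_def
    by (intro continuous_intros continuous_on_compose2[OF g(1)]) (use that ab in \<open>auto simp: D_def\<close>)
  have contE: "continuous_on {0..E1} (\<lambda>E. \<theta> E b)"
    unfolding \<theta>_def h_def
    by (intro continuous_intros continuous_on_compose2[OF g(1)]) (use ab in \<open>auto simp: D_def\<close>)
  have \<theta>a: "\<theta> E a = 0" for E by (simp add: \<theta>_def h_def)
  \<comment> \<open>Reaching \<open>pi\<close> would give the solution at energy 0 a second zero,
    which \<open>dirichlet_solution_of_nonneg\<close> forbids.\<close>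
  have low: "\<theta> 0 b < pi"
  proof (rule ccontr)
    assume "\<not> \<theta> 0 b < pi"
    then obtain x0 where x0: "a \<le> x0" "x0 \<le> b" "\<theta> 0 x0 = pi"
      using IVT'[of "\<theta> 0" a pi b] \<theta>a ab cont\<theta>[of 0] E1 by auto
    then have "U 0 x0 = 0" "a < x0" using polar[of 0 x0] E1 \<theta>a[of 0] by (auto simp: order_less_le)
    then have "W 0 a = 0"
      using dirichlet_solution_of_nonneg[OF sol[of 0] q _ _ x0(2) init(1)] v(2) by auto
    then show False using init(2)[of 0] by simp
  qed
  have cross: "\<theta> E1 y > real n * pi" if "a \<le> x" "x < y" "y \<le> b" "\<theta> E1 x \<ge> real n * pi" for n x y
  proof (rule prufer_crossing[OF cont\<theta> _ _ _ solves_deriv[OF sol] that])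
    show "exp (Re (h E1 x)) > 0" for x by simp
  qed (use E1 polar in auto)
  \<comment> \<open>At a zero of \<open>U\<close> the angle is an integer multiple of
    \<open>pi\<close>, so exceeding \<open>n * pi\<close> means reaching the next multiple.\<close>
  have up: "\<theta> E1 x \<ge> real (Suc n) * pi" if x: "x \<in> {a..b}" "U E1 x = 0" "\<theta> E1 x > real n * pi" for x n
  proof -
    have "sin (\<theta> E1 x) = 0" using polar[of E1 x] x E1 by auto
    then obtain i :: int where i: "\<theta> E1 x = of_int i * pi" using sin_zero_iff_int2 by auto
    then have "real n < of_int i" using x(3) by simp
    then have "int (Suc n) \<le> i" by linarith
    then have "real (Suc n) \<le> of_int i" by linarith
    then show ?thesis unfolding i by (intro mult_right_mono) auto
  qed
  obtain x1 x2 where x: "a < x1" "x1 < x2" "x2 < b" "U E1 x1 = 0" "U E1 x2 = 0"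
    using zeros[OF sol] by blast
  \<comment> \<open>The angle is positive right of \<open>a\<close>. Alternating \<open>up\<close>
    at a zero with \<open>cross\<close> after it, it is at least \<open>pi\<close> at
    \<open>x1\<close>, at least \<open>2 * pi\<close> at \<open>x2\<close> and strictly above
    \<open>2 * pi\<close> at \<open>b\<close>.\<close>
  have "\<theta> E1 x1 \<ge> real (Suc 0) * pi" using x \<theta>a[of E1] cross[of a x1 0] by (intro up) auto
  then have "\<theta> E1 x2 > real (Suc 0) * pi" using x by (intro cross[of x1 x2]) auto
  then have "\<theta> E1 x2 \<ge> real (Suc (Suc 0)) * pi" using x by (intro up) auto
  then have high: "\<theta> E1 b > 2 * pi" using cross[of x2 b 2] x by auto
  obtain E where E: "0 \<le> E" "E \<le> E1" "\<theta> E b = pi"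
    using IVT'[of "\<lambda>E. \<theta> E b" 0 pi E1] low high E1 contE pi_gt_zero by (smt (verit))
  obtain E' where E': "0 \<le> E'" "E' \<le> E1" "\<theta> E' b = 2 * pi"
    using IVT'[of "\<lambda>E. \<theta> E b" 0 "2 * pi" E1] low high E1 contE pi_gt_zero by (smt (verit))
  have "U E b = 0" "U E' b = 0" "E \<noteq> E'"
    using polar(1)[of E b] polar(1)[of E' b] E E' ab by auto
  then show ?thesis using sol init E E' by (intro exI[of _ E] exI[of _ E']) blast
qed

section \<open>Eigenspaces\<close>

lemma AE_lebesgue_on_interiorD:
  assumes "AE x in lebesgue_on {a<..<b::real}. P x"
  shows "AE x in lebesgue. x \<in> {a..b} \<longrightarrow> P x"
proof -
  have "AE x in lebesgue. x \<in> {a<..<b} \<longrightarrow> P x"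
    using assms by (subst (asm) AE_restrict_space_iff) auto
  moreover have "AE x in lebesgue. x \<notin> {a, b}"
    by (intro AE_not_in) (auto simp: negligible_iff_null_sets[symmetric])
  ultimately show ?thesis by eventually_elim auto
qed

text \<open>Passes from complex Lebesgue primitives to real Henstock--Kurzweil ones. In use,
  \<open>T\<close> is the real or imaginary part, up to sign.\<close>

lemma primitive_real_linear:
  fixes f g :: "real \<Rightarrow> complex" and T :: "complex \<Rightarrow> real"
  assumes "abs_cont_deriv a b f g" and T: "bounded_linear T"
  shows "(\<lambda>x. T (g x)) integrable_on {a..b}"
    and "x \<in> {a..b} \<Longrightarrow> T (f x) = T (f a) + integral {a..x} (\<lambda>x. T (g x))"
proof -
  have i: "integrable (lebesgue_on {a..b}) g"
    and eq: "\<And>x. x \<in> {a..b} \<Longrightarrow> f x = f a + (LINT t|lebesgue_on {a..x}. g t)"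
    using assms(1) unfolding abs_cont_deriv_def by blast+
  have ix: "integrable (lebesgue_on {a..x}) g" if "x \<in> {a..b}" for x
    using that by (intro integrable_subinterval[OF i]) auto
  have gi: "g integrable_on {a..x}" if "x \<in> {a..b}" for x
    using ix[OF that] by (intro integrable_on_lebesgue_on) auto
  show "(\<lambda>x. T (g x)) integrable_on {a..b}"
  proof (cases "a \<le> b")
    case True
    then show ?thesis using integrable_linear[OF gi[of b] T] by (simp add: o_def)
  qed auto
  assume x: "x \<in> {a..b}"
  have "T (f x) = T (f a) + T (integral {a..x} g)"
    by (subst eq[OF x]) (simp add: lebesgue_integral_eq_integral[OF ix[OF x]]
        linear_add[OF bounded_linear.linear[OF T]])
  also have "T (integral {a..x} g) = integral {a..x} (\<lambda>x. T (g x))"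
    using integral_linear[OF gi[OF x] T] by (simp add: o_def)
  finally show "T (f x) = T (f a) + integral {a..x} (\<lambda>x. T (g x))" .
qed

lemma primitive_continuous:
  fixes f g :: "real \<Rightarrow> real"
  assumes "g integrable_on {a..b}" "\<And>x. x \<in> {a..b} \<Longrightarrow> f x = f a + integral {a..x} g"
  shows "continuous_on {a..b} f"
proof (rule continuous_on_eq)
  show "continuous_on {a..b} (\<lambda>x. f a + integral {a..x} g)"
    by (intro continuous_intros indefinite_integral_continuous_1 assms(1))
qed (simp add: assms(2)[symmetric])

text \<open>The eigenvalue equation holds almost everywhere, and the integrated form absorbs the
  null set. One \<open>f'\<close> serves all \<open>T\<close>, so the real and imaginary parts can
  later be reassembled.\<close>

lemma eigenspace_solves:
  assumes f: "f \<in> eigenspace v L \<mu>"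
  obtains f' where "\<And>T. bounded_linear T \<Longrightarrow>
      solves (\<lambda>x. v x - \<mu>) (-L/2) (L/2) (\<lambda>x. T (f x)) (\<lambda>x. T (f' x) :: real)"
proof -
  obtain f' f'' where ac: "abs_cont_deriv (-L/2) (L/2) f f'" "abs_cont_deriv (-L/2) (L/2) f' f''"
    and ae: "AE x in lebesgue_on {-L/2<..<L/2}. complex_of_real \<mu> * f x = - f'' x + complex_of_real (v x) * f x"
    using f unfolding eigenspace_def dirichlet_schroedinger_def by auto
  have ae': "AE x in lebesgue. x \<in> {-L/2..L/2} \<longrightarrow> complex_of_real \<mu> * f x = - f'' x + complex_of_real (v x) * f x"
    by (rule AE_lebesgue_on_interiorD[OF ae])
  then obtain N where N: "N \<in> null_sets lebesgue"
    "\<And>x. x \<in> {-L/2..L/2} - N \<Longrightarrow> complex_of_real \<mu> * f x = - f'' x + complex_of_real (v x) * f x"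
    by (auto elim!: AE_E3)
  then have N': "f'' x = complex_of_real (v x - \<mu>) * f x" if "x \<in> {-L/2..L/2} - N" for x
    using N(2)[OF that] by (simp add: algebra_simps)
  have "solves (\<lambda>x. v x - \<mu>) (-L/2) (L/2) (\<lambda>x. T (f x)) (\<lambda>x. T (f' x))"
    if T: "bounded_linear T" for T :: "complex \<Rightarrow> real"
    unfolding solves_def
  proof (intro conjI ballI)
    note p1 = primitive_real_linear[OF ac(1) T] and p2 = primitive_real_linear[OF ac(2) T]
    show "continuous_on {-L/2..L/2} (\<lambda>x. T (f x))" by (rule primitive_continuous[OF p1])
    show "continuous_on {-L/2..L/2} (\<lambda>x. T (f' x))" by (rule primitive_continuous[OF p2])
    fix x assume x: "x \<in> {-L/2..L/2}"
    show "T (f x) = T (f (-L/2)) + integral {-L/2..x} (\<lambda>x. T (f' x))" using p1(2)[OF x] .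
    have "integral {-L/2..x} (\<lambda>x. T (f'' x)) = integral {-L/2..x} (\<lambda>t. (v t - \<mu>) * T (f t))"
    proof (rule integral_spike)
      show "negligible N" using N(1) by (simp add: negligible_iff_null_sets)
      fix t assume "t \<in> {-L/2..x} - N"
      then have "f'' t = (v t - \<mu>) *\<^sub>R f t" using N'[of t] x by (auto simp: scaleR_conv_of_real)
      then show "(v t - \<mu>) * T (f t) = T (f'' t)"
        by (simp add: linear_scale[OF bounded_linear.linear[OF T]])
    qed
    then show "T (f' x) = T (f' (-L/2)) + integral {-L/2..x} (\<lambda>t. (v t - \<mu>) * T (f t))"
      using p2(2)[OF x] by simp
  qed
  then show ?thesis using that by blast
qed

lemma eigenspaceD:
  assumes "f \<in> eigenspace v L \<mu>"
  shows "x \<notin> {-L/2..L/2} \<Longrightarrow> f x = 0" "f (-L/2) = 0" "f (L/2) = 0"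
  using assms unfolding eigenspace_def dirichlet_schroedinger_def by auto

text \<open>The way back from Henstock--Kurzweil to Lebesgue integrals, for which absolute
  integrability is assumed.\<close>

lemma abs_cont_deriv_of_real:
  assumes g: "g absolutely_integrable_on {a..b}"
    and f: "\<And>x. x \<in> {a..b} \<Longrightarrow> f x = f a + integral {a..x} g"
  shows "abs_cont_deriv a b (\<lambda>x. complex_of_real (f x)) (\<lambda>x. complex_of_real (g x))"
proof -
  have i: "integrable (lebesgue_on {a..b}) g"
    using g by (simp add: integrable_restrict_space set_integrable_def)
  have "integrable (lebesgue_on {a..x}) g" if "x \<in> {a..b}" for x
    using that by (intro integrable_subinterval[OF i]) auto
  then have "f x = f a + (LINT t|lebesgue_on {a..x}. g t)" if "x \<in> {a..b}" for x
    using f[OF that] that by (simp add: lebesgue_integral_eq_integral)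
  then have "complex_of_real (f x) = complex_of_real (f a) + (LINT t|lebesgue_on {a..x}. complex_of_real (g t))"
    if "x \<in> {a..b}" for x
    unfolding integral_complex_of_real of_real_add[symmetric] using that by (simp only:)
  then show ?thesis
    unfolding abs_cont_deriv_def using i by (blast intro: complex_of_real_integrable_eq[THEN iffD2])
qed

text \<open>The second derivative is \<open>(v - \<mu>) * u\<close>, a bounded measurable function
  times a continuous one, hence square integrable. Extension by zero selects the representative
  demanded by the operator domain.\<close>

lemma solution_in_eigenspace:
  assumes s: "solves (\<lambda>x. v x - \<mu>) (-L/2) (L/2) u w" and v: "bdd_meas v" and L: "L > 0"
    and bc: "u (-L/2) = 0" "u (L/2) = 0"
  shows "(\<lambda>x. if x \<in> {-L/2..L/2} then complex_of_real (u x) else 0) \<in> eigenspace v L \<mu>"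
proof -
  let ?a = "-L/2" and ?b = "L/2"
  define q where "q = (\<lambda>x. v x - \<mu>)"
  have q: "bdd_meas q" unfolding q_def using v by (intro bdd_meas_diff) auto
  have sq: "solves q ?a ?b u w" using s by (simp add: q_def)
  note c = solvesD(1,2)[OF sq]
  define f where "f = (\<lambda>x. if x \<in> {?a..?b} then u x else 0)"
  have "abs_cont_deriv ?a ?b (\<lambda>x. complex_of_real (f x)) (\<lambda>x. complex_of_real (w x))"
  proof (rule abs_cont_deriv_of_real)
    show "w absolutely_integrable_on {?a..?b}" by (rule absolutely_integrable_continuous_real[OF c(2)])
    show "f x = f ?a + integral {?a..x} w" if "x \<in> {?a..?b}" for x
      using solvesD(3)[OF sq that] that L by (simp add: f_def)
  qed
  moreover have ai: "(\<lambda>x. q x * u x) absolutely_integrable_on {?a..?b}"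
    by (rule abs_integrable_bdd_meas_mult[OF q c(1)])
  then have "abs_cont_deriv ?a ?b (\<lambda>x. complex_of_real (w x)) (\<lambda>x. complex_of_real (q x * u x))"
    by (rule abs_cont_deriv_of_real) (rule solvesD(4)[OF sq])
  moreover have "L2_on {?a<..<?b} (\<lambda>x. complex_of_real (q x * u x))"
    unfolding L2_on_def
  proof
    have "(\<lambda>x. q x * u x) absolutely_integrable_on {?a<..<?b}"
      using ai by (rule set_integrable_subset) auto
    then have "(\<lambda>x. q x * u x) \<in> borel_measurable (lebesgue_on {?a<..<?b})"
      by (auto simp: absolutely_integrable_measurable)
    then show "(\<lambda>x. complex_of_real (q x * u x)) \<in> borel_measurable (lebesgue_on {?a<..<?b})"
      by (rule measurable_compose) (intro borel_measurable_continuous_onI continuous_intros)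
    have "(\<lambda>x. q x * (u x * u x)) absolutely_integrable_on {?a..?b}"
      by (intro abs_integrable_bdd_meas_mult q continuous_on_mult c)
    \<comment> \<open>The square is written with the two factors \<open>q\<close> in front so that
      multiplication by a bounded measurable function applies twice.\<close>
    then have "(\<lambda>x. q x * (q x * (u x * u x))) absolutely_integrable_on {?a<..<?b}"
      by (rule set_integrable_subset[OF abs_integrable_bdd_meas_mult_left[OF q]]) auto
    then have "integrable (lebesgue_on {?a<..<?b}) (\<lambda>x. q x * (q x * (u x * u x)))"
      by (simp add: integrable_restrict_space set_integrable_def)
    moreover have "(\<lambda>x. q x * (q x * (u x * u x))) = (\<lambda>x. (cmod (complex_of_real (q x * u x)))\<^sup>2)"
      by (simp add: norm_mult power2_eq_square mult_ac flip: abs_mult)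
    ultimately show "integrable (lebesgue_on {?a<..<?b}) (\<lambda>x. (cmod (complex_of_real (q x * u x)))\<^sup>2)"
      by simp
  qed
  moreover have "AE x in lebesgue_on {?a<..<?b}. complex_of_real \<mu> * complex_of_real (f x) =
      - complex_of_real (q x * u x) + complex_of_real (v x) * complex_of_real (f x)"
    by (rule AE_I2) (auto simp: f_def q_def algebra_simps space_restrict_space)
  moreover have "\<forall>x. x \<notin> {?a..?b} \<longrightarrow> complex_of_real (f x) = 0" "complex_of_real (f ?a) = 0" "complex_of_real (f ?b) = 0"
    using bc by (simp_all add: f_def)
  moreover have eq: "(\<lambda>x. if x \<in> {?a..?b} then complex_of_real (u x) else 0) = (\<lambda>x. complex_of_real (f x))"
    by (auto simp: f_def)
  ultimately show ?thesis
    unfolding eq eigenspace_def dirichlet_schroedinger_def mem_Collect_eq prod.case by blast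
qed

text \<open>The extended solution is nonzero because its slope at the left end is 1. By uniqueness,
  applied to real and imaginary parts, an eigenfunction \<open>g\<close> is the multiple
  \<open>g' (-L/2)\<close> of it.\<close>

lemma multiplicity_eq_1:
  assumes s: "solves (\<lambda>x. v x - \<mu>) (-L/2) (L/2) u w" and v: "bdd_meas v" and L: "L > 0"
    and bc: "u (-L/2) = 0" "w (-L/2) = 1" "u (L/2) = 0"
  shows "multiplicity_ev v L \<mu> = 1"
proof -
  let ?a = "-L/2" and ?b = "L/2"
  have q: "bdd_meas (\<lambda>x. v x - \<mu>)" using v by (intro bdd_meas_diff) auto
  define f where "f = (\<lambda>x. if x \<in> {?a..?b} then complex_of_real (u x) else 0)"
  have f: "f \<in> eigenspace v L \<mu>"
    unfolding f_def by (rule solution_in_eigenspace[OF s v L bc(1,3)])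
  have f0: "f \<noteq> (\<lambda>x. 0)"
  proof
    assume "f = (\<lambda>x. 0)"
    then have "f x = 0" for x by simp
    then have u0: "u x = 0" if "x \<in> {?a..?b}" for x
      using that unfolding f_def by (metis of_real_eq_0_iff)
    have "(u has_real_derivative w ?a) (at ?a within {?a..?b})"
      using solves_deriv[OF s, of ?a] L by simp
    moreover have "(u has_real_derivative 0) (at ?a within {?a..?b})"
      by (rule has_field_derivative_transform_within[OF DERIV_const zero_less_one]) (use u0 L in auto)
    ultimately have "w ?a = 0"
      using L by (intro vector_derivative_unique_within_closed_interval[of ?a ?b ?a u])
        (auto simp: has_real_derivative_iff_has_vector_derivative)
    then show False using bc by simp
  qed
  have "eigenspace v L \<mu> \<subseteq> cfun.span {f}"
  proof
    fix g assume g: "g \<in> eigenspace v L \<mu>"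
    obtain g' where g': "\<And>T. bounded_linear T \<Longrightarrow>
      solves (\<lambda>x. v x - \<mu>) ?a ?b (\<lambda>x. T (g x)) (\<lambda>x. T (g' x) :: real)"
      using eigenspace_solves[OF g] by blast
    have *: "T (g x) = T (g' ?a) * u x" if "x \<in> {?a..?b}" "bounded_linear T" for T x
      using solves_unique(1)[OF g'[OF that(2)] solves_linear[OF s s q, of "T (g' ?a)" 0] q _ _ that(1)]
        bc eigenspaceD(2)[OF g] that(2) by (simp add: linear_0[OF bounded_linear.linear])
    have "g x = g' ?a * f x" for x
    proof (cases "x \<in> {?a..?b}")
      case True
      then show ?thesis
        using *[OF True bounded_linear_Re] *[OF True bounded_linear_Im] by (simp add: f_def complex_eq_iff)
    next
      case False
      then show ?thesis using eigenspaceD(1)[OF g False] by (simp only: f_def if_False mult_zero_right)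
    qed
    then have "g = (\<lambda>x. g' ?a * f x)" by auto
    then show "g \<in> cfun.span {f}" using cfun.span_scale[OF cfun.span_base[of f "{f}"], of "g' ?a"] by simp
  qed
  moreover have "{f} \<subseteq> eigenspace v L \<mu>" using f by simp
  moreover have "cfun.independent {f}"
    using f0 by (simp add: zero_fun_def)
  ultimately show ?thesis
    unfolding multiplicity_ev_def using cfun.basis_card_eq_dim[of "{f}" "eigenspace v L \<mu>"] by simp
qed

text \<open>Positive dimension gives an eigenfunction that is nonzero at some \<open>x0\<close>; one
  of its real or imaginary parts, up to sign, is positive there.\<close>

lemma multiplicity_pos_imp_solution:
  assumes m: "multiplicity_ev v L \<mu> > 0" and v: "bdd_meas v"
  obtains u w x0 where "solves (\<lambda>x. v x - \<mu>) (-L/2) (L/2) u w" "u (-L/2) = 0" "u (L/2) = 0"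
    "x0 \<in> {-L/2..L/2}" "u x0 > 0"
proof -
  have "\<exists>f\<in>eigenspace v L \<mu>. f \<noteq> 0"
  proof (rule ccontr)
    assume "\<not> ?thesis"
    then have "eigenspace v L \<mu> \<subseteq> cfun.span {}" by auto
    then have "cfun.dim (eigenspace v L \<mu>) = 0"
      using cfun.basis_card_eq_dim[of "{}" "eigenspace v L \<mu>"] cfun.independent_empty by simp
    with m show False by (simp add: multiplicity_ev_def)
  qed
  then obtain f x0 where f: "f \<in> eigenspace v L \<mu>" "f x0 \<noteq> 0" by (auto simp: fun_eq_iff)
  obtain f' where f': "\<And>T. bounded_linear T \<Longrightarrow>
      solves (\<lambda>x. v x - \<mu>) (-L/2) (L/2) (\<lambda>x. T (f x)) (\<lambda>x. T (f' x) :: real)"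
    using eigenspace_solves[OF f(1)] by blast
  obtain T :: "complex \<Rightarrow> real" where T: "bounded_linear T" "T (f x0) > 0"
  proof (cases "Re (f x0) = 0")
    case False
    then show ?thesis
      using that[OF bounded_linear_Re] that[OF bounded_linear_minus[OF bounded_linear_Re]]
      by (cases "Re (f x0) > 0") auto
  next
    case True
    with f(2) have "Im (f x0) \<noteq> 0" by (simp add: complex_eq_iff)
    then show ?thesis
      using that[OF bounded_linear_Im] that[OF bounded_linear_minus[OF bounded_linear_Im]]
      by (cases "Im (f x0) > 0") auto
  qed
  have "x0 \<in> {-L/2..L/2}" using eigenspaceD(1)[OF f(1)] f(2) by blast
  then show ?thesis
    using that[OF f'[OF T(1)]] eigenspaceD(2,3)[OF f(1)] T
    by (simp add: linear_0[OF bounded_linear.linear])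
qed

text \<open>The operator sees \<open>v\<close> only up to null sets, which permits the change to a
  representative with pointwise bounds.\<close>

lemma spectral_gap_cong_AE:
  assumes "AE x in lebesgue. v x = v' x"
  shows "spectral_gap v = spectral_gap v'"
proof -
  have sub: "dirichlet_schroedinger v L \<subseteq> dirichlet_schroedinger v' L"
    if "AE x in lebesgue. v x = v' x" for v v' L
  proof
    have ae: "AE x in lebesgue_on {-L/2<..<L/2}. v x = v' x"
      using that by (subst AE_restrict_space_iff) auto
    fix p assume "p \<in> dirichlet_schroedinger v L"
    then obtain f g f' f'' where p: "p = (f, g)" "\<forall>x. x \<notin> {-L/2..L/2} \<longrightarrow> f x = 0" "f (-L/2) = 0" "f (L/2) = 0"
       "abs_cont_deriv (-L/2) (L/2) f f'" "abs_cont_deriv (-L/2) (L/2) f' f''"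
       "L2_on {-L/2<..<L/2} f''"
      and g: "AE x in lebesgue_on {-L/2<..<L/2}. g x = - f'' x + complex_of_real (v x) * f x"
      unfolding dirichlet_schroedinger_def by auto
    have "AE x in lebesgue_on {-L/2<..<L/2}. g x = - f'' x + complex_of_real (v' x) * f x"
      using g ae by eventually_elim simp
    then show "p \<in> dirichlet_schroedinger v' L"
      using p unfolding dirichlet_schroedinger_def by blast
  qed
  have "AE x in lebesgue. v' x = v x" using assms by eventually_elim simp
  then have "dirichlet_schroedinger v = dirichlet_schroedinger v'"
    using sub[OF assms] sub[of v' v] by (intro ext) blast
  then show ?thesis
    by (simp add: fun_eq_iff spectral_gap_def eigenvalue_def multiplicity_ev_def eigenspace_def)
qed

section \<open>The spectral gap\<close>

text \<open>\<open>E1\<close> belongs to \<open>S 1\<close>, witnessed by \<open>{E, E'}\<close>,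
  and each element of \<open>S 0\<close> dominates an eigenvalue, hence \<open>m\<close>. With
  \<open>S 1 \<subseteq> S 0\<close> both sets are nonempty and bounded below, so the real infima
  obey the usual laws.\<close>

lemma spectral_gap_bounds:
  assumes low: "\<And>\<mu>. multiplicity_ev v L \<mu> > 0 \<Longrightarrow> m \<le> \<mu>"
    and E: "E \<noteq> E'" "E \<le> E1" "E' \<le> E1" "multiplicity_ev v L E = 1" "multiplicity_ev v L E' = 1"
  shows "0 \<le> spectral_gap v L" "spectral_gap v L \<le> E1 - m"
proof -
  define S where "S = (\<lambda>n::nat. {E. \<exists>M. finite M \<and> M \<subseteq> {..E} \<and> n + 1 \<le> (\<Sum>\<mu>\<in>M. multiplicity_ev v L \<mu>)})"
  have ev: "eigenvalue v L n = Inf (S n)" for n by (simp add: eigenvalue_def S_def)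
  have S10: "S 1 \<subseteq> S 0" unfolding S_def by fastforce
  have lb: "m \<le> x" if "x \<in> S 0" for x
  proof -
    obtain M where M: "finite M" "M \<subseteq> {..x}" "1 \<le> (\<Sum>\<mu>\<in>M. multiplicity_ev v L \<mu>)"
      using \<open>x \<in> S 0\<close> unfolding S_def by auto
    then obtain \<mu> where "\<mu> \<in> M" "multiplicity_ev v L \<mu> > 0"
      by (metis not_one_le_zero sum.neutral zero_less_iff_neq_zero)
    with low[of \<mu>] M(2) show ?thesis by force
  qed
  have E1: "E1 \<in> S 1"
    unfolding S_def using E by (auto intro!: exI[of _ "{E, E'}"])
  have bdd: "bdd_below (S 0)" "bdd_below (S 1)" using lb S10 by (auto intro!: bdd_belowI)
  have "Inf (S 0) \<le> Inf (S 1)" using S10 E1 bdd by (intro cInf_superset_mono) auto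
  then show "0 \<le> spectral_gap v L" by (simp add: spectral_gap_def ev)
  have "Inf (S 1) \<le> E1" using E1 bdd by (intro cInf_lower) auto
  moreover have "m \<le> Inf (S 0)" using lb E1 S10 by (intro cInf_greatest) auto
  ultimately show "spectral_gap v L \<le> E1 - m" by (simp add: spectral_gap_def ev)
qed

section \<open>Eigenvalue bounds for large \<open>L\<close>\<close>

lemma sin_ge_sin_of_mem:
  assumes "0 \<le> a" "a \<le> t" "t \<le> pi - a"
  shows "sin a \<le> sin t"
proof (cases "t \<le> pi / 2")
  case True
  then show ?thesis using assms by (intro sin_monotone_2pi_le) auto
next
  case False
  then have "sin a \<le> sin (pi - t)" using assms by (intro sin_monotone_2pi_le) auto
  then show ?thesis by simp
qed

text \<open>With \<open>k = (2 * pi - \<delta>) / L\<close> the phase \<open>k * (L / 2 + x)\<close>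
  is \<open>pi - \<delta> / 2\<close> at the origin and moves by less than
  \<open>\<delta> / 4\<close> over \<open>[-R, R]\<close> for large \<open>L\<close>. As
  \<open>\<delta> \<le> pi\<close>, it stays between \<open>\<delta> / 4\<close> and
  \<open>pi - \<delta> / 4\<close>, so \<open>\<sigma> = sin (\<delta> / 4)\<close> is independent
  of \<open>L\<close> and the bound of \<open>integral_potential_bound\<close> tends to 0.\<close>

lemma eventually_eigenvalues_ge:
  assumes v: "bdd_meas v" "\<And>x. 0 \<le> v x" and R: "R > 0" "integral {-R..R} v > 0"
    and \<delta>: "0 < \<delta>" "\<delta> \<le> pi"
  shows "\<forall>\<^sub>F L in at_top. \<forall>\<mu>. multiplicity_ev v L \<mu> > 0 \<longrightarrow> ((2 * pi - \<delta>) / L)\<^sup>2 \<le> \<mu>"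
proof -
  define k where "k = (\<lambda>L. (2 * pi - \<delta>) / L)"
  define \<sigma> where "\<sigma> = sin (\<delta> / 4)"
  have \<sigma>: "\<sigma> > 0" unfolding \<sigma>_def using \<delta> by (intro sin_gt_zero) auto
  have k0: "(k \<longlongrightarrow> 0) at_top"
    unfolding k_def by (intro tendsto_divide_0[OF tendsto_const] filterlim_at_top_imp_at_infinity filterlim_ident)
  have "((\<lambda>L. k L * R) \<longlongrightarrow> 0 * R) at_top"
    by (intro tendsto_intros k0)
  then have ev1: "\<forall>\<^sub>F L in at_top. k L * R < \<delta> / 4"
    using \<delta> by (intro order_tendstoD(2)) auto
  have "((\<lambda>L. 2 * k L / \<sigma> + 2 * R * ((k L)\<^sup>2 + (k L / \<sigma>)\<^sup>2)) \<longlongrightarrow>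
      2 * 0 / \<sigma> + 2 * R * (0\<^sup>2 + (0 / \<sigma>)\<^sup>2)) at_top"
    using \<sigma> by (intro tendsto_intros k0) auto
  then have ev2: "\<forall>\<^sub>F L in at_top. 2 * k L / \<sigma> + 2 * R * ((k L)\<^sup>2 + (k L / \<sigma>)\<^sup>2) < integral {-R..R} v"
    using R by (intro order_tendstoD(2)) auto
  show ?thesis
    using ev1 ev2 eventually_gt_at_top[of "2 * R"]
  proof eventually_elim
    case (elim L)
    have L: "L > 0" using elim R by linarith
    have kp: "k L > 0" using L \<delta> pi_gt_zero unfolding k_def by (intro divide_pos_pos) linarith+
    have kL: "k L * (L / 2) = pi - \<delta> / 2" using L by (simp add: k_def field_simps)
    show ?case
    proof (intro allI impI)
      fix \<mu> assume "multiplicity_ev v L \<mu> > 0"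
      from multiplicity_pos_imp_solution[OF this v(1)] obtain u w x0 where
        s: "solves (\<lambda>x. v x - \<mu>) (-L/2) (L/2) u w" "u (-L/2) = 0" "u (L/2) = 0"
        and x0: "x0 \<in> {-L/2..L/2}" "u x0 > 0" by blast
      show "((2 * pi - \<delta>) / L)\<^sup>2 \<le> \<mu>"
      proof (rule ccontr)
        assume "\<not> ?thesis"
        then have \<mu>: "\<mu> < (k L)\<^sup>2" by (simp add: k_def)
        have up: "k L * (L / 2 + x) \<le> pi - \<delta> / 4" if "x \<le> R" for x
          unfolding distrib_left kL using mult_left_mono[OF that less_imp_le[OF kp]] elim(1) by linarith
        have lo: "\<delta> / 4 \<le> k L * (L / 2 + x)" if "- R \<le> x" for x
          unfolding distrib_left kL
          using mult_left_mono[OF that less_imp_le[OF kp]] elim(1) \<delta>(2) by linarith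
        have "integral {-R..R} v \<le> 2 * k L / \<sigma> + 2 * R * ((k L)\<^sup>2 + (k L / \<sigma>)\<^sup>2)"
        proof (rule integral_potential_bound[OF v R(1) _ \<sigma> kp \<mu>])
          show "solves (\<lambda>x. v x - \<mu>) (- (L / 2)) (L / 2) u w" using s(1) by simp
          show "R < L / 2" using elim by simp
          show "0 < sin (k L * (L / 2 + x))" if "- (L / 2) < x" "x \<le> R" for x
            using up[OF that(2)] that kp \<delta> by (intro sin_gt_zero mult_pos_pos) auto
          show "\<sigma> \<le> sin (k L * (L / 2 + x))" if "x \<in> {-R..R}" for x
            unfolding \<sigma>_def using up[of x] lo[of x] that \<delta> by (intro sin_ge_sin_of_mem) auto
          show "u (- (L / 2)) = 0" "u (L / 2) = 0" "x0 \<in> {- (L / 2)..L / 2}" "u x0 > 0"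
            using s x0 by auto
        qed
        with elim(2) show False by simp
      qed
    qed
  qed
qed

text \<open>Sturm comparison on the two outer intervals, where the potential is
  \<open>o(1/L\<^sup>2)\<close>, gives every solution at the upper energy two interior zeros. This
  is the input of \<open>shooting\<close>, and the solutions it returns have simple
  eigenvalues.\<close>

lemma eventually_two_eigenvalues_le:
  assumes v: "bdd_meas v" "\<And>x. 0 \<le> v x" and decay: "\<And>x. v x \<le> C / \<bar>x\<bar> powr \<alpha>"
    and C: "C > 0" "\<alpha> > 2" and \<delta>: "\<delta> > 0"
  shows "\<forall>\<^sub>F L in at_top. \<exists>E E'. E \<noteq> E' \<and> E \<le> ((2 * pi + \<delta>) / L)\<^sup>2 \<and> E' \<le> ((2 * pi + \<delta>) / L)\<^sup>2 \<and>
           multiplicity_ev v L E = 1 \<and> multiplicity_ev v L E' = 1"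
proof -
  \<comment> \<open>\<open>r * L\<close> is the half period of a sine with frequency
    \<open>(2 * pi + \<delta> / 2) / L\<close>. It falls short of \<open>L / 2\<close>, which leaves
    a central gap of half-width \<open>\<eta> * L\<close> between two outer intervals of this
    length.\<close>
  define r where "r = pi / (2 * pi + \<delta> / 2)"
  define \<eta> where "\<eta> = 1 / 2 - r"
  have pp: "2 * pi + \<delta> / 2 > 0" using \<delta> pi_gt_zero by (intro add_pos_pos) auto
  have r: "r > 0" unfolding r_def using pp by (intro divide_pos_pos) auto
  have \<eta>: "\<eta> > 0" unfolding \<eta>_def r_def using pp \<delta> by (simp add: field_simps)
  \<comment> \<open>\<open>D / L\<^sup>2\<close> is the energy margin between the frequencies with
    \<open>\<delta>\<close> and with \<open>\<delta> / 2\<close>; it absorbs the tail of the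
    potential.\<close>
  define D where "D = (2 * pi + \<delta>)\<^sup>2 - (2 * pi + \<delta> / 2)\<^sup>2"
  have D: "D > 0" unfolding D_def using \<delta> pp by (simp add: power_strict_mono)
  have "((\<lambda>L. C / \<eta> powr \<alpha> * L powr (2 - \<alpha>)) \<longlongrightarrow> C / \<eta> powr \<alpha> * 0) at_top"
    using C by (intro tendsto_intros tendsto_neg_powr filterlim_ident) auto
  then have ev: "\<forall>\<^sub>F L in at_top. C / \<eta> powr \<alpha> * L powr (2 - \<alpha>) < D"
    using D by (intro order_tendstoD(2)) auto
  show ?thesis
    using ev eventually_gt_at_top[of 0]
  proof eventually_elim
    case (elim L)
    note L = elim(2)
    define E1 where "E1 = ((2 * pi + \<delta>) / L)\<^sup>2"
    define m where "m = E1 - C / (\<eta> * L) powr \<alpha>"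
    have q: "bdd_meas (\<lambda>x. v x - E1)" using v by (intro bdd_meas_diff) auto
    have "L\<^sup>2 * (C / (\<eta> * L) powr \<alpha>) = C / \<eta> powr \<alpha> * L powr (2 - \<alpha>)"
      using L \<eta> by (simp add: powr_mult powr_diff)
    then have "L\<^sup>2 * m = (2 * pi + \<delta>)\<^sup>2 - C / \<eta> powr \<alpha> * L powr (2 - \<alpha>)"
      using L by (simp add: m_def E1_def power_divide right_diff_distrib)
    then have "(2 * pi + \<delta> / 2)\<^sup>2 < L\<^sup>2 * m" using elim(1) by (simp add: D_def)
    then have "((2 * pi + \<delta> / 2) / L)\<^sup>2 < m"
      unfolding power_divide using L by (subst pos_divide_less_eq) (auto simp: mult.commute)
    moreover have "pi / (r * L) = (2 * pi + \<delta> / 2) / L" using pp by (simp add: r_def)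
    ultimately have m: "(pi / (r * L))\<^sup>2 < m" by (simp only:)
    have qm: "v x - E1 \<le> - m" if "\<eta> * L \<le> \<bar>x\<bar>" for x
    proof -
      have "C / \<bar>x\<bar> powr \<alpha> \<le> C / (\<eta> * L) powr \<alpha>"
        using C mult_pos_pos[OF \<eta> L] that by (intro divide_left_mono powr_mono2 mult_pos_pos) auto
      with decay[of x] show ?thesis by (simp add: m_def)
    qed
    have zeros: "\<exists>x1 x2. -L/2 < x1 \<and> x1 < x2 \<and> x2 < L/2 \<and> u x1 = 0 \<and> u x2 = 0"
      if s: "solves (\<lambda>x. v x - E1) (-L/2) (L/2) u w" for u w
    proof -
      have len: "- (\<eta> * L) - (-L/2) = r * L" "L/2 - \<eta> * L = r * L"
        by (simp_all add: \<eta>_def field_simps)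
      have pos: "r * L > 0" "\<eta> * L > 0" using r \<eta> L by auto
      have "\<exists>x\<in>{-L/2<..< - (\<eta> * L)}. u x = 0"
      proof (rule sturm_zero[OF solves_subinterval[OF s q] q])
        show "(pi / (- (\<eta> * L) - (-L/2)))\<^sup>2 < m" unfolding len by (rule m)
        show "v x - E1 \<le> - m" if "x \<in> {-L/2..- (\<eta> * L)}" for x
          using that pos by (intro qm) auto
      qed (use len pos in linarith)+
      moreover have "\<exists>x\<in>{\<eta> * L<..<L/2}. u x = 0"
      proof (rule sturm_zero[OF solves_subinterval[OF s q] q])
        show "(pi / (L/2 - \<eta> * L))\<^sup>2 < m" unfolding len by (rule m)
        show "v x - E1 \<le> - m" if "x \<in> {\<eta> * L..L/2}" for x
          using that pos by (intro qm) auto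
      qed (use len pos in linarith)+
      ultimately obtain x1 x2 where "-L/2 < x1" "x1 < - (\<eta> * L)" "u x1 = 0"
          "\<eta> * L < x2" "x2 < L/2" "u x2 = 0" by auto
      with pos show ?thesis by (intro exI[of _ x1] exI[of _ x2]) simp
    qed
    have ab: "-L/2 < L/2" "0 \<le> E1" using L by (simp_all add: E1_def)
    define S where "S = (\<lambda>E. \<exists>u w. solves (\<lambda>x. v x - E) (-L/2) (L/2) u w \<and>
      u (-L/2) = 0 \<and> w (-L/2) = 1 \<and> u (L/2) = 0)"
    have "\<exists>E E'. E \<noteq> E' \<and> E \<le> E1 \<and> E' \<le> E1 \<and> S E \<and> S E'"
      unfolding S_def by (rule shooting[OF v ab]) (rule zeros)
    then obtain E E' where E: "E \<noteq> E'" "E \<le> E1" "E' \<le> E1" "S E" "S E'" by blast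
    have "multiplicity_ev v L E = 1" if "S E" for E
      using that multiplicity_eq_1[OF _ v(1) L] unfolding S_def by blast
    with E have "multiplicity_ev v L E = 1" "multiplicity_ev v L E' = 1" by blast+
    with E show ?case unfolding E1_def by blast
  qed
qed

text \<open>If all integrals over \<open>[-n, n]\<close> vanished, the nonnegative \<open>v\<close>
  would be zero almost everywhere on each of these countably many intervals, hence on the
  line.\<close>

lemma exists_interval_integral_pos:
  assumes v: "bdd_meas v" "\<And>x. 0 \<le> v x" and nz: "\<not> (AE x in lebesgue. v x = 0)"
  obtains R where "R > 0" "integral {-R..R} v > 0"
proof -
  have "\<exists>n::nat. integral {-real n..real n} v > 0"
  proof (rule ccontr)
    assume no: "\<not> ?thesis"
    have "AE x in lebesgue. x \<in> {-real n..real n} \<longrightarrow> v x = 0" for n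
    proof -
      have "v absolutely_integrable_on {-real n..real n}"
        using abs_integrable_bdd_meas_mult[OF v(1) continuous_on_const[of _ 1]] by simp
      then have i: "integrable (lebesgue_on {-real n..real n}) v"
        by (simp add: integrable_restrict_space set_integrable_def)
      have "integral\<^sup>L (lebesgue_on {-real n..real n}) v = integral {-real n..real n} v"
        by (rule lebesgue_integral_eq_integral[OF i]) simp
      moreover have "integral\<^sup>L (lebesgue_on {-real n..real n}) v \<ge> 0"
        using v(2) by simp
      ultimately have "integral\<^sup>L (lebesgue_on {-real n..real n}) v = 0"
        using no by (metis order_antisym not_le)
      then have "AE x in lebesgue_on {-real n..real n}. v x = 0"
        using integral_nonneg_eq_0_iff_AE[OF i] v(2) by simp
      then show ?thesis by (subst (asm) AE_restrict_space_iff) auto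
    qed
    then have "AE x in lebesgue. \<forall>n. x \<in> {-real n..real n} \<longrightarrow> v x = 0"
      unfolding AE_all_countable by blast
    then have "AE x in lebesgue. v x = 0"
    proof eventually_elim
      case (elim x)
      obtain n :: nat where "\<bar>x\<bar> \<le> real n" using real_arch_simple by blast
      then have "x \<in> {-real n..real n}" by auto
      with elim show ?case by blast
    qed
    with nz show False by blast
  qed
  then obtain n :: nat where n: "integral {-real n..real n} v > 0" by blast
  then have "n \<noteq> 0" by (intro notI) simp
  with n that[of "real n"] show ?thesis by simp
qed

theorem theorem2p5:
  fixes v :: "real \<Rightarrow> real" and C \<alpha> :: real
  assumes "v \<in> borel_measurable lebesgue"
    and "\<exists>B. AE x in lebesgue. \<bar>v x\<bar> \<le> B"
    and "AE x in lebesgue. 0 \<le> v x"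
    and "\<not> (AE x in lebesgue. v x = 0)"
    and "C > 0" and "\<alpha> > 2"
    and "AE x in lebesgue. \<bar>v x\<bar> \<le> C / \<bar>x\<bar> powr \<alpha>"
  shows "((\<lambda>L. L\<^sup>2 * spectral_gap v L) \<longlongrightarrow> 0) at_top"
proof -
  obtain B where B: "AE x in lebesgue. \<bar>v x\<bar> \<le> B" using assms(2) by blast
  \<comment> \<open>This representative satisfies the three almost-everywhere bounds at every point.
    At 0 the decay bound reads 0, since \<open>0 powr \<alpha> = 0\<close> and division by zero
    yields 0, so \<open>v0 0 = 0\<close>.\<close>
  define v0 where "v0 = (\<lambda>x. if 0 \<le> v x \<and> v x \<le> B \<and> v x \<le> C / \<bar>x\<bar> powr \<alpha> then v x else 0)"
  have v_eq: "AE x in lebesgue. v x = v0 x"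
    using B assms(3,7) by eventually_elim (auto simp: v0_def)
  have [measurable]: "v \<in> borel_measurable lebesgue" by fact
  have [measurable]: "(\<lambda>x. C / \<bar>x\<bar> powr \<alpha>) \<in> borel_measurable lebesgue"
    by (intro measurable_completion) measurable
  have "v0 \<in> borel_measurable lebesgue" unfolding v0_def by measurable
  moreover have "bounded (range v0)"
    unfolding bounded_iff by (intro exI[of _ "\<bar>B\<bar>"]) (auto simp: v0_def)
  ultimately have v0: "bdd_meas v0" by (simp add: bdd_meas_def)
  have nn: "0 \<le> v0 x" and dec: "v0 x \<le> C / \<bar>x\<bar> powr \<alpha>" for x
    using assms(5) by (auto simp: v0_def)
  have "\<not> (AE x in lebesgue. v0 x = 0)"
  proof
    assume "AE x in lebesgue. v0 x = 0"
    with v_eq have "AE x in lebesgue. v x = 0" by eventually_elim simp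
    with assms(4) show False by blast
  qed
  then obtain R where R: "R > 0" "integral {-R..R} v0 > 0"
    using exists_interval_integral_pos[OF v0 nn] by blast
  have "((\<lambda>L. L\<^sup>2 * spectral_gap v0 L) \<longlongrightarrow> 0) at_top"
  proof (rule tendstoI)
    fix e :: real assume e: "e > 0"
    \<comment> \<open>The two bounds differ by \<open>(2 * pi + \<delta>)\<^sup>2 - (2 * pi -
      \<delta>)\<^sup>2 = 8 * pi * \<delta>\<close> after scaling by \<open>L\<^sup>2\<close>, and
      this is at most \<open>e / 2\<close>. The cap \<open>pi\<close> is required by the lower
      bound.\<close>
    define \<delta> where "\<delta> = min pi (e / (16 * pi))"
    have \<delta>: "0 < \<delta>" "\<delta> \<le> pi" "8 * pi * \<delta> < e"
      using e by (auto simp: \<delta>_def min_def field_simps)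
    show "\<forall>\<^sub>F L in at_top. dist (L\<^sup>2 * spectral_gap v0 L) 0 < e"
      using eventually_eigenvalues_ge[OF v0 nn R \<delta>(1,2)]
        eventually_two_eigenvalues_le[OF v0 nn dec assms(5,6) \<delta>(1)] eventually_gt_at_top[of 0]
    proof eventually_elim
      case (elim L)
      obtain E E' where "E \<noteq> E'" "E \<le> ((2 * pi + \<delta>) / L)\<^sup>2" "E' \<le> ((2 * pi + \<delta>) / L)\<^sup>2"
           "multiplicity_ev v0 L E = 1" "multiplicity_ev v0 L E' = 1" using elim(2) by blast
      note gap = spectral_gap_bounds[OF elim(1)[rule_format] this]
      have "L\<^sup>2 * spectral_gap v0 L \<le> L\<^sup>2 * (((2 * pi + \<delta>) / L)\<^sup>2 - ((2 * pi - \<delta>) / L)\<^sup>2)"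
        by (intro mult_left_mono gap) auto
      also have "\<dots> = 8 * pi * \<delta>"
        using elim(3) by (simp add: field_simps power2_eq_square)
      finally show ?case using \<delta>(3) gap(1) by (simp add: dist_real_def)
    qed
  qed
  then show ?thesis unfolding spectral_gap_cong_AE[OF v_eq] .
qed

end
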